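(* Let $p\ge3$, $X\mid\theta\sim N_p(\theta,D)$ with $D=\operatorname{diag}(d_1,\ldots,d_p)$, $d_j>0$, and let the prior be $\theta\sim N(0,\Gamma)$ with $\Gamma=\operatorname{diag}(\gamma_1,\ldots,\gamma_p)$, $\gamma_j\ge0$. Let $d_j^*=d_j^2/(d_j+\gamma_j)$ with indices sorted so that $d_1^*\ge\cdots\ge d_p^*$. Let $A^\dagger=\operatorname{diag}(a_1^\dagger,\ldots,a_p^\dagger)$ be the unique maximizer of $c^*(D,A)=\sum_j d_ja_j-2\max_j d_ja_j$ over $a_j\ge0$ with $\sum_j(d_j+\gamma_j)a_j^2=\sum_j d_j^*$, let $\nu$ be the largest index with $d_\nu a_\nu^\dagger=\max_j d_ja_j^\dagger$, and let $\delta_{A^\dagger(\Gamma)}(X)=X-\frac{c^*(D,A^\dagger)}{X^\top A^{\dagger\top}A^\dagger X}A^\dagger X$. Denote by $R(\delta,\pi_\Gamma)=E^{\pi_\Gamma}E_\theta\|\delta(X)-\theta\|^2$ the Bayes risk. If $\nu=3$, then \[ R\{\delta_{A^\dagger(\Gamma)},\pi_\Gamma\}\le\operatorname{tr}(D)-\sum_{j=3}^p d_j^*+\Big(d_3^*-\frac{2}{p-2}\sum_{j=4}^pd_j^*-\frac{p}{p-2}\frac{d_3^*}{3}\Big)\le\operatorname{tr}(D)-\sum_{j=3}^p d_j^*+\frac23d_3^*. \] If $\nu\ge4$, then \[ R\{\delta_{A^\dagger(\Gamma)},\pi_\Gamma\}\le\operatorname{tr}(D)-\sum_{j=3}^p d_j^*+\Big(d_3^*+d_4^*-\frac{2}{p-2}\sum_{j=5}^pd_j^*-\frac{4p}{p-2}\frac{d_\nu^*}{\nu}\Big)\le\operatorname{tr}(D)-\sum_{j=3}^p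 d_j^*+(d_3^*+d_4^* ). \]
   Context: The maximizer $A^\dagger$ exists and is unique. An empty summation is $0$. $E^{\pi_\Gamma}$ denotes expectation over $\theta\sim N(0,\Gamma)$ and $E_\theta$ expectation over $X\sim N(\theta,D)$. *)

theory Defs
  imports "HOL-Probability.Probability"
begin

definition normal_meas :: "real \<Rightarrow> real \<Rightarrow> real measure" where
  "normal_meas m v = (if v = 0 then return lborel m
                      else density lborel (normal_density m (sqrt v)))"

definition gauss_diag :: "nat \<Rightarrow> (nat \<Rightarrow> real) \<Rightarrow> (nat \<Rightarrow> real) \<Rightarrow> (nat \<Rightarrow> real) measure" where
  "gauss_diag p m v = PiM {1..p} (\<lambda>j. normal_meas (m j) (v j))"

definition bayes_risk ::
  "nat \<Rightarrow> (nat \<Rightarrow> real) \<Rightarrow> (nat \<Rightarrow> real) \<Rightarrow> ((nat \<Rightarrow> real) \<Rightarrow> (nat \<Rightarrow> real)) \<Rightarrow> ennreal" where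
  "bayes_risk p d \<gamma> \<delta> =
     (\<integral>\<^sup>+ \<theta>. (\<integral>\<^sup>+ x. ennreal (\<Sum>j\<in>{1..p}. (\<delta> x j - \<theta> j)\<^sup>2) \<partial>gauss_diag p \<theta> d)
        \<partial>gauss_diag p (\<lambda>_. 0) \<gamma>)"

definition dstar :: "(nat \<Rightarrow> real) \<Rightarrow> (nat \<Rightarrow> real) \<Rightarrow> nat \<Rightarrow> real" where
  "dstar d \<gamma> j = d j ^ 2 / (d j + \<gamma> j)"

definition cstar :: "nat \<Rightarrow> (nat \<Rightarrow> real) \<Rightarrow> (nat \<Rightarrow> real) \<Rightarrow> real" where
  "cstar p d a = (\<Sum>j\<in>{1..p}. d j * a j) - 2 * Max ((\<lambda>j. d j * a j) ` {1..p})"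

definition feasible :: "nat \<Rightarrow> (nat \<Rightarrow> real) \<Rightarrow> (nat \<Rightarrow> real) \<Rightarrow> (nat \<Rightarrow> real) \<Rightarrow> bool" where
  "feasible p d \<gamma> a \<longleftrightarrow> (\<forall>j\<in>{1..p}. a j \<ge> 0) \<and>
     (\<Sum>j\<in>{1..p}. (d j + \<gamma> j) * (a j)\<^sup>2) = (\<Sum>j\<in>{1..p}. dstar d \<gamma> j)"

definition nu_idx :: "nat \<Rightarrow> (nat \<Rightarrow> real) \<Rightarrow> (nat \<Rightarrow> real) \<Rightarrow> nat" where
  "nu_idx p d a = (GREATEST k. k \<in> {1..p} \<and> d k * a k = Max ((\<lambda>j. d j * a j) ` {1..p}))"

definition delta_A :: "nat \<Rightarrow> (nat \<Rightarrow> real) \<Rightarrow> (nat \<Rightarrow> real) \<Rightarrow> (nat \<Rightarrow> real) \<Rightarrow> (nat \<Rightarrow> real)" where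
  "delta_A p d a x = (\<lambda>j. x j - cstar p d a / (\<Sum>k\<in>{1..p}. (a k * x k)\<^sup>2) * (a j * x j))"

end

theory Submission
  imports Defs
begin

text \<open>
  By Bayes' rule for Gaussian measures the Bayes risk is a single integral over the marginal law
  \<open>X \<sim> N(0, D + \<Gamma>)\<close>, with the posterior mean and variance of \<open>\<theta>\<close> in place of \<open>\<theta>\<close>. In terms of
  standard normal \<open>g\<^sub>j\<close> it is \<open>tr D - 2 c E[\<Sum>j. b\<^sub>j g\<^sub>j\<^sup>2 / S] + c\<^sup>2 E[1 / S]\<close> with \<open>b\<^sub>j = d\<^sub>j a\<^sub>j\<close>,
  \<open>s\<^sub>j = (d\<^sub>j + \<gamma>\<^sub>j) a\<^sub>j\<^sup>2\<close> and \<open>S = \<Sum>j. s\<^sub>j g\<^sub>j\<^sup>2\<close>. Writing \<open>1 / S\<close> as the integral of \<open>exp (- t S)\<close>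
  over \<open>t \<ge> 0\<close>, where \<open>E exp (- t S) = \<Prod>j. (1 + 2 t s\<^sub>j) powr (- 1 / 2)\<close>, yields Stein's identity, hence
  the bound \<open>tr D - c\<^sup>2 E[1 / S]\<close>, and, by AM-GM, \<open>E[1 / S] \<ge> p / ((p - 2) \<Sum>j. s\<^sub>j)\<close>.
  The maximizer has the form \<open>b\<^sub>j = min M (\<lambda> d\<^sub>j\<^sup>*)\<close> with \<open>M = Max b\<close>, so that \<open>c\<^sup>2 / \<Sum>j. s\<^sub>j\<close> equals
  \<open>(\<nu> - 2)\<^sup>2 / (\<Sum>j\<le>\<nu>. 1 / d\<^sub>j\<^sup>*) + (\<Sum>j>\<nu>. d\<^sub>j\<^sup>*)\<close>, which is bounded below by induction on \<open>\<nu>\<close>.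
\<close>

subsection \<open>Product measures\<close>

lemma distr_PiM_componentwise:
  assumes I: "finite I" and M: "\<And>i. prob_space (M i)"
    and T [measurable]: "\<And>i. T i \<in> M i \<rightarrow>\<^sub>M L i"
  shows "distr (PiM I M) (PiM I L) (\<lambda>x. \<lambda>i\<in>I. T i (x i)) = PiM I (\<lambda>i. distr (M i) (L i) (T i))"
    (is "distr _ _ ?T = _")
proof (rule product_sigma_finite.PiM_eqI)
  interpret M: product_prob_space M UNIV by (rule product_prob_spaceI) (rule M)
  interpret D: product_prob_space "\<lambda>i. distr (M i) (L i) (T i)" UNIV
    by (intro product_prob_spaceI prob_space.prob_space_distr M T)
  show "product_sigma_finite (\<lambda>i. distr (M i) (L i) (T i))" ..
  fix A assume A: "\<And>i. i \<in> I \<Longrightarrow> A i \<in> sets (distr (M i) (L i) (T i))"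
  have "?T -` Pi\<^sub>E I A \<inter> space (PiM I M) = (\<Pi>\<^sub>E i\<in>I. T i -` A i \<inter> space (M i))"
    by (auto simp: space_PiM PiE_iff)
  moreover have "emeasure (distr (PiM I M) (PiM I L) ?T) (Pi\<^sub>E I A) =
      emeasure (PiM I M) (?T -` Pi\<^sub>E I A \<inter> space (PiM I M))"
    by (rule emeasure_distr) (use A I in \<open>auto intro!: sets_PiM_I_finite\<close>)
  moreover have "emeasure (PiM I M) (\<Pi>\<^sub>E i\<in>I. T i -` A i \<inter> space (M i)) =
      (\<Prod>i\<in>I. emeasure (M i) (T i -` A i \<inter> space (M i)))"
    by (rule M.emeasure_PiM[OF I]) (use A in auto)
  ultimately show "emeasure (distr (PiM I M) (PiM I L) ?T) (Pi\<^sub>E I A) =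
      (\<Prod>i\<in>I. emeasure (distr (M i) (L i) (T i)) (A i))"
    using A by (simp add: emeasure_distr cong: prod.cong)
qed (simp_all add: I cong: sets_PiM_cong)

lemma distr_pair_PiM_zip:
  assumes I: "finite I" and M: "\<And>i. prob_space (M i)" and N: "\<And>i. prob_space (N i)"
  shows "distr (PiM I M \<Otimes>\<^sub>M PiM I N) (PiM I (\<lambda>i. M i \<Otimes>\<^sub>M N i)) (\<lambda>z. \<lambda>i\<in>I. (fst z i, snd z i)) =
    PiM I (\<lambda>i. M i \<Otimes>\<^sub>M N i)" (is "distr ?PQ ?R ?zip = _")
proof (rule product_sigma_finite.PiM_eqI)
  interpret M: product_prob_space M UNIV by (rule product_prob_spaceI) (rule M)
  interpret N: product_prob_space N UNIV by (rule product_prob_spaceI) (rule N)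
  interpret Q: prob_space "PiM I N" by (rule prob_space_PiM) (rule N)
  interpret MN: product_prob_space "\<lambda>i. M i \<Otimes>\<^sub>M N i" UNIV
    by (intro product_prob_spaceI prob_space_pair M N)
  show "product_sigma_finite (\<lambda>i. M i \<Otimes>\<^sub>M N i)" ..
  fix A assume "\<And>i. i \<in> I \<Longrightarrow> A i \<in> sets (M i \<Otimes>\<^sub>M N i)"
  note A [measurable] = this
  have [measurable]: "?zip \<in> ?PQ \<rightarrow>\<^sub>M ?R" by measurable
  have box: "Pi\<^sub>E I A \<in> sets ?R" by (intro sets_PiM_I_finite I A)
  then have [measurable]: "(\<lambda>z. indicator (Pi\<^sub>E I A) (?zip z) :: ennreal) \<in> borel_measurable ?PQ"
    by measurable
  have "emeasure (distr ?PQ ?R ?zip) (Pi\<^sub>E I A) = (\<integral>\<^sup>+ z. indicator (Pi\<^sub>E I A) (?zip z) \<partial>?PQ)"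
    using box by (simp add: nn_integral_distr flip: nn_integral_indicator)
  also have "\<dots> = (\<integral>\<^sup>+ x. \<integral>\<^sup>+ y. indicator (Pi\<^sub>E I A) (?zip (x, y)) \<partial>PiM I N \<partial>PiM I M)"
    by (rule Q.nn_integral_fst[symmetric]) measurable
  also have "\<dots> = (\<integral>\<^sup>+ x. \<integral>\<^sup>+ y. (\<Prod>i\<in>I. indicator (A i) (x i, y i)) \<partial>PiM I N \<partial>PiM I M)"
    by (intro nn_integral_cong) (auto simp: indicator_def I PiE_iff prod_zero_iff)
  also have "\<dots> = (\<integral>\<^sup>+ x. (\<Prod>i\<in>I. \<integral>\<^sup>+ u. indicator (A i) (x i, u) \<partial>N i) \<partial>PiM I M)"
  proof (intro nn_integral_cong N.product_nn_integral_prod I)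
    fix x i assume "x \<in> space (PiM I M)" "i \<in> I"
    then show "(\<lambda>u. indicator (A i) (x i, u) :: ennreal) \<in> borel_measurable (N i)"
      by (intro measurable_compose[OF measurable_Pair1'] borel_measurable_indicator A)
        (auto simp: space_PiM PiE_iff)
  qed
  also have "\<dots> = (\<Prod>i\<in>I. \<integral>\<^sup>+ t. \<integral>\<^sup>+ u. indicator (A i) (t, u) \<partial>N i \<partial>M i)"
    by (rule M.product_nn_integral_prod[OF I]) measurable
  also have "\<dots> = (\<Prod>i\<in>I. emeasure (M i \<Otimes>\<^sub>M N i) (A i))"
    by (intro prod.cong refl) (simp add: N.M.emeasure_pair_measure)
  finally show "emeasure (distr ?PQ ?R ?zip) (Pi\<^sub>E I A) = (\<Prod>i\<in>I. emeasure (M i \<Otimes>\<^sub>M N i) (A i))" .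
qed (simp_all add: I)

lemma nn_integral_PiM_component:
  assumes "\<And>i. i \<in> I \<Longrightarrow> prob_space (M i)" "j \<in> I" and [measurable]: "f \<in> borel_measurable (M j)"
  shows "(\<integral>\<^sup>+ x. f (x j) \<partial>PiM I M) = (\<integral>\<^sup>+ y. f y \<partial>M j)"
proof -
  have "(\<integral>\<^sup>+ y. f y \<partial>M j) = (\<integral>\<^sup>+ y. f y \<partial>distr (PiM I M) (M j) (\<lambda>x. x j))"
    using distr_PiM_component[of I M j] assms by simp
  then show ?thesis
    using assms(2) by (simp add: nn_integral_distr)
qed

subsection \<open>Gaussian measures as images of standard normals\<close>

definition std_normal :: "real measure" where
  "std_normal = density lborel std_normal_density"

abbreviation std_gauss :: "'i set \<Rightarrow> ('i \<Rightarrow> real) measure" where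
  "std_gauss I \<equiv> PiM I (\<lambda>_. std_normal)"

lemma sets_std_normal [simp, measurable_cong]: "sets std_normal = sets borel"
  by (simp add: std_normal_def)

lemma space_std_normal [simp]: "space std_normal = UNIV"
  by (simp add: std_normal_def)

interpretation std_normal: prob_space std_normal
  unfolding std_normal_def by (rule prob_space_normal_density) simp

interpretation std_gauss: product_prob_space "\<lambda>_. std_normal" UNIV
  by unfold_locales

lemma prob_space_std_gauss: "prob_space (std_gauss I)"
  by (intro prob_space_PiM std_normal.prob_space_axioms)

lemma normal_meas_eq_distr:
  assumes "v \<ge> 0"
  shows "normal_meas m v = distr std_normal lborel (\<lambda>z. m + sqrt v * z)"
proof (cases "v = 0")
  case True
  then show ?thesis
    using std_normal.distr_const[of m lborel] by (simp add: normal_meas_def)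
next
  case False
  with assms have v: "sqrt v > 0" by simp
  have "distributed std_normal lborel (\<lambda>x. x) std_normal_density"
    by (simp add: distributed_def std_normal_def distr_id2)
  from std_normal.normal_density_affine[OF this _ less_imp_neq[OF v, symmetric], of m]
  show ?thesis
    using False v by (simp add: distributed_def normal_meas_def)
qed

lemma prob_space_normal_meas: "v \<ge> 0 \<Longrightarrow> prob_space (normal_meas m v)"
  by (simp add: normal_meas_eq_distr std_normal.prob_space_distr)

lemma sets_normal_meas [simp, measurable_cong]: "sets (normal_meas m v) = sets borel"
  by (simp add: normal_meas_def)

lemma nn_integral_normal_meas:
  assumes "v \<ge> 0" and [measurable]: "f \<in> borel_measurable borel"
  shows "(\<integral>\<^sup>+ x. f x \<partial>normal_meas m v) = (\<integral>\<^sup>+ z. f (m + sqrt v * z) \<partial>std_normal)"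
  unfolding normal_meas_eq_distr[OF assms(1)] by (rule nn_integral_distr) measurable

lemma gauss_diag_eq_distr:
  assumes "\<And>j. j \<in> {1..p} \<Longrightarrow> v j \<ge> 0"
  shows "gauss_diag p m v = distr (std_gauss {1..p}) (PiM {1..p} (\<lambda>_. lborel))
    (\<lambda>z. \<lambda>j\<in>{1..p}. m j + sqrt (v j) * z j)"
proof -
  have "gauss_diag p m v = PiM {1..p} (\<lambda>j. distr std_normal lborel (\<lambda>z. m j + sqrt (v j) * z))"
    unfolding gauss_diag_def by (intro PiM_cong refl normal_meas_eq_distr assms)
  also have "\<dots> = distr (std_gauss {1..p}) (PiM {1..p} (\<lambda>_. lborel))
      (\<lambda>z. \<lambda>j\<in>{1..p}. m j + sqrt (v j) * z j)"
    by (rule distr_PiM_componentwise[symmetric]) (auto intro: std_normal.prob_space_axioms)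
  finally show ?thesis .
qed

lemma sets_gauss_diag [simp, measurable_cong]:
  "sets (gauss_diag p m v) = sets (PiM {1..p} (\<lambda>_. borel))"
  unfolding gauss_diag_def by (intro sets_PiM_cong) auto

lemma nn_integral_gauss_diag:
  assumes "\<And>j. j \<in> {1..p} \<Longrightarrow> v j \<ge> 0"
    and [measurable]: "f \<in> borel_measurable (PiM {1..p} (\<lambda>_. borel))"
  shows "(\<integral>\<^sup>+ x. f x \<partial>gauss_diag p m v) =
    (\<integral>\<^sup>+ z. f (\<lambda>j\<in>{1..p}. m j + sqrt (v j) * z j) \<partial>std_gauss {1..p})"
proof -
  have [measurable_cong]: "sets (PiM {1..p} (\<lambda>_. lborel)) = sets (PiM {1..p} (\<lambda>_. borel :: real measure))"
    by (intro sets_PiM_cong) auto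
  show ?thesis
    by (subst gauss_diag_eq_distr, fact) (rule nn_integral_distr; measurable)
qed

lemma
  shows integrable_std_normal_ident: "integrable std_normal (\<lambda>y. y)"
    and integral_std_normal_ident: "(\<integral>y. y \<partial>std_normal) = 0"
    and integrable_std_normal_square: "integrable std_normal (\<lambda>y. y\<^sup>2)"
    and integral_std_normal_square: "(\<integral>y. y\<^sup>2 \<partial>std_normal) = 1"
  using integrable_std_normal_moment[of 1] integral_std_normal_moment_odd[of 0]
    integrable_std_normal_moment[of 2] integral_std_normal_moment_even[of 1]
  by (simp_all add: std_normal_def integrable_density integral_density fact_numeral)

lemma
  assumes "j \<in> I"
  shows integrable_std_gauss_square: "integrable (std_gauss I) (\<lambda>x. (x j)\<^sup>2)"
    and integral_std_gauss_square: "(\<integral>x. (x j)\<^sup>2 \<partial>std_gauss I) = 1"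
proof -
  have component: "distr (std_gauss I) std_normal (\<lambda>x. x j) = std_normal"
    by (rule distr_PiM_component) (use assms std_normal.prob_space_axioms in auto)
  have [measurable]: "(\<lambda>x. x j) \<in> std_gauss I \<rightarrow>\<^sub>M std_normal"
    using assms by measurable
  show "integrable (std_gauss I) (\<lambda>x. (x j)\<^sup>2)"
    using integrable_std_normal_square
    by (subst (asm) component[symmetric]) (simp add: integrable_distr_eq)
  show "(\<integral>x. (x j)\<^sup>2 \<partial>std_gauss I) = 1"
    using integral_std_normal_square
    by (subst (asm) component[symmetric]) (simp add: integral_distr)
qed

lemma nn_integral_normal_meas_sq_diff:
  assumes "v \<ge> 0"
  shows "(\<integral>\<^sup>+ t. ennreal ((y - t)\<^sup>2) \<partial>normal_meas m v) = ennreal ((y - m)\<^sup>2 + v)"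
proof -
  have expand: "(y - (m + sqrt v * z))\<^sup>2 = (y - m)\<^sup>2 - 2 * (y - m) * sqrt v * z + v * z\<^sup>2" for z
    using assms by (simp add: power2_eq_square algebra_simps)
  have integrable: "integrable std_normal (\<lambda>z. (y - (m + sqrt v * z))\<^sup>2)"
    unfolding expand
    by (intro Bochner_Integration.integrable_add Bochner_Integration.integrable_diff
      integrable_mult_right integrable_std_normal_ident integrable_std_normal_square
      std_normal.integrable_const)
  have "(\<integral>\<^sup>+ t. ennreal ((y - t)\<^sup>2) \<partial>normal_meas m v) =
      (\<integral>\<^sup>+ z. ennreal ((y - (m + sqrt v * z))\<^sup>2) \<partial>std_normal)"
    using assms by (rule nn_integral_normal_meas) measurable
  also have "\<dots> = ennreal (\<integral>z. (y - (m + sqrt v * z))\<^sup>2 \<partial>std_normal)"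
    by (rule nn_integral_eq_integral[OF integrable]) simp
  also have "(\<integral>z. (y - (m + sqrt v * z))\<^sup>2 \<partial>std_normal) = (y - m)\<^sup>2 + v"
    unfolding expand using std_normal.prob_space
    by (simp add: integrable_std_normal_ident integrable_std_normal_square
      integral_std_normal_ident integral_std_normal_square)
  finally show ?thesis .
qed

lemma nn_integral_gauss_diag_sum_sq_diff:
  assumes v: "\<And>j. j \<in> {1..p} \<Longrightarrow> v j \<ge> 0"
  shows "(\<integral>\<^sup>+ \<theta>. ennreal (\<Sum>j\<in>{1..p}. (y j - \<theta> j)\<^sup>2) \<partial>gauss_diag p m v) =
    ennreal (\<Sum>j\<in>{1..p}. (y j - m j)\<^sup>2 + v j)"
proof -
  have "(\<integral>\<^sup>+ \<theta>. ennreal (\<Sum>j\<in>{1..p}. (y j - \<theta> j)\<^sup>2) \<partial>gauss_diag p m v) =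
      (\<Sum>j\<in>{1..p}. \<integral>\<^sup>+ \<theta>. ennreal ((y j - \<theta> j)\<^sup>2) \<partial>gauss_diag p m v)"
    by (subst nn_integral_sum[symmetric]) auto
  also have "\<dots> = (\<Sum>j\<in>{1..p}. ennreal ((y j - m j)\<^sup>2 + v j))"
  proof (intro sum.cong refl)
    fix j assume j: "j \<in> {1..p}"
    have "(\<integral>\<^sup>+ \<theta>. ennreal ((y j - \<theta> j)\<^sup>2) \<partial>gauss_diag p m v) =
        (\<integral>\<^sup>+ t. ennreal ((y j - t)\<^sup>2) \<partial>normal_meas (m j) (v j))"
      unfolding gauss_diag_def using j v
      by (intro nn_integral_PiM_component prob_space_normal_meas) auto
    then show "(\<integral>\<^sup>+ \<theta>. ennreal ((y j - \<theta> j)\<^sup>2) \<partial>gauss_diag p m v) = ennreal ((y j - m j)\<^sup>2 + v j)"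
      by (simp only: nn_integral_normal_meas_sq_diff[OF v[OF j]])
  qed
  also have "\<dots> = ennreal (\<Sum>j\<in>{1..p}. (y j - m j)\<^sup>2 + v j)"
    using v by (intro sum_ennreal) simp
  finally show ?thesis .
qed

subsection \<open>Bayes' rule for Gaussian priors\<close>

text \<open>The joint law of \<open>(T, X)\<close> with \<open>T\<close> distributed as \<open>N(0, u)\<close> and \<open>X\<close> given \<open>T\<close> as \<open>N(k T, w)\<close>.\<close>

definition gauss_pair :: "real \<Rightarrow> real \<Rightarrow> real \<Rightarrow> (real \<times> real) measure" where
  "gauss_pair u k w = distr (std_normal \<Otimes>\<^sub>M std_normal) (borel \<Otimes>\<^sub>M borel)
     (\<lambda>z. (sqrt u * fst z, k * (sqrt u * fst z) + sqrt w * snd z))"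

lemma sets_gauss_pair [simp, measurable_cong]: "sets (gauss_pair u k w) = sets (borel \<Otimes>\<^sub>M borel)"
  by (simp add: gauss_pair_def)

lemma prob_space_gauss_pair: "prob_space (gauss_pair u k w)"
  unfolding gauss_pair_def
  by (intro prob_space.prob_space_distr prob_space_pair std_normal.prob_space_axioms) measurable

lemma nn_integral_gauss_pair:
  assumes u: "u \<ge> 0" and w: "w \<ge> 0" and [measurable]: "f \<in> borel_measurable (borel \<Otimes>\<^sub>M borel)"
  shows "(\<integral>\<^sup>+ z. f z \<partial>gauss_pair u k w) =
    (\<integral>\<^sup>+ t. \<integral>\<^sup>+ x. f (t, x) \<partial>normal_meas (k * t) w \<partial>normal_meas 0 u)"
proof -
  have "(\<integral>\<^sup>+ z. f z \<partial>gauss_pair u k w) =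
      (\<integral>\<^sup>+ z. f (sqrt u * fst z, k * (sqrt u * fst z) + sqrt w * snd z) \<partial>(std_normal \<Otimes>\<^sub>M std_normal))"
    unfolding gauss_pair_def by (rule nn_integral_distr) measurable
  also have "\<dots> = (\<integral>\<^sup>+ g. \<integral>\<^sup>+ h. f (sqrt u * g, k * (sqrt u * g) + sqrt w * h) \<partial>std_normal \<partial>std_normal)"
    by (subst std_normal.nn_integral_fst[symmetric]) auto
  also have "\<dots> = (\<integral>\<^sup>+ t. \<integral>\<^sup>+ x. f (t, x) \<partial>normal_meas (k * t) w \<partial>normal_meas 0 u)"
    using u w by (simp add: nn_integral_normal_meas)
  finally show ?thesis .
qed

lemma normal_density_conjugate:
  fixes \<gamma> d t x :: real
  assumes "\<gamma> > 0" "d > 0"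
  defines "v \<equiv> d + \<gamma>"
  shows "normal_density 0 (sqrt \<gamma>) t * normal_density t (sqrt d) x =
    normal_density 0 (sqrt v) x * normal_density (\<gamma> / v * x) (sqrt (\<gamma> * d / v)) t"
proof -
  have v: "v > 0" using assms by simp
  have "v * (t - \<gamma> / v * x)\<^sup>2 = v * t\<^sup>2 - 2 * \<gamma> * t * x + \<gamma>\<^sup>2 * x\<^sup>2 / v"
    using v by (simp add: power2_eq_square field_simps)
  then have "x\<^sup>2 / (2 * v) + (t - \<gamma> / v * x)\<^sup>2 / (2 * (\<gamma> * d / v)) =
      x\<^sup>2 / (2 * v) + (v * t\<^sup>2 - 2 * \<gamma> * t * x + \<gamma>\<^sup>2 * x\<^sup>2 / v) / (2 * \<gamma> * d)"
    by (simp add: mult.commute)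
  also have "\<dots> = t\<^sup>2 / (2 * \<gamma>) + (x - t)\<^sup>2 / (2 * d)"
    using assms v by (simp add: power2_eq_square divide_simps) (simp add: v_def algebra_simps)
  finally have exponent: "- t\<^sup>2 / (2 * \<gamma>) + - (x - t)\<^sup>2 / (2 * d) =
      - x\<^sup>2 / (2 * v) + - (t - \<gamma> / v * x)\<^sup>2 / (2 * (\<gamma> * d / v))"
    by simp
  have scale: "sqrt (2 * pi * \<gamma>) * sqrt (2 * pi * d) = sqrt (2 * pi * v) * sqrt (2 * pi * (\<gamma> * d / v))"
    using v by (simp flip: real_sqrt_mult)
  have "normal_density 0 (sqrt \<gamma>) t * normal_density t (sqrt d) x =
      1 / (sqrt (2 * pi * \<gamma>) * sqrt (2 * pi * d)) * exp (- t\<^sup>2 / (2 * \<gamma>) + - (x - t)\<^sup>2 / (2 * d))"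
    using assms by (simp only: normal_density_def exp_add) simp
  also have "\<dots> = normal_density 0 (sqrt v) x * normal_density (\<gamma> / v * x) (sqrt (\<gamma> * d / v)) t"
    unfolding exponent scale using assms v by (simp only: normal_density_def exp_add) simp
  finally show ?thesis .
qed

lemma nn_integral_normal_bayes:
  fixes f :: "real \<times> real \<Rightarrow> ennreal"
  assumes \<gamma>: "\<gamma> \<ge> 0" and d: "d > 0" and [measurable]: "f \<in> borel_measurable (borel \<Otimes>\<^sub>M borel)"
  defines "v \<equiv> d + \<gamma>"
  shows "(\<integral>\<^sup>+ t. \<integral>\<^sup>+ x. f (t, x) \<partial>normal_meas t d \<partial>normal_meas 0 \<gamma>) =
    (\<integral>\<^sup>+ x. \<integral>\<^sup>+ t. f (t, x) \<partial>normal_meas (\<gamma> / v * x) (\<gamma> * d / v) \<partial>normal_meas 0 v)"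
proof (cases "\<gamma> = 0")
  case True
  have "(\<lambda>t. \<integral>\<^sup>+ x. f (t, x) \<partial>normal_meas t d) \<in> borel_measurable borel"
    using d by (simp add: nn_integral_normal_meas)
  then show ?thesis
    using True by (simp add: normal_meas_def nn_integral_return v_def)
next
  case False
  let ?prior = "\<lambda>t. ennreal (normal_density 0 (sqrt \<gamma>) t)"
    and ?likelihood = "\<lambda>t x. ennreal (normal_density t (sqrt d) x)"
    and ?marginal = "\<lambda>x. ennreal (normal_density 0 (sqrt v) x)"
    and ?posterior = "\<lambda>x t. ennreal (normal_density (\<gamma> / v * x) (sqrt (\<gamma> * d / v)) t)"
  have pos: "\<gamma> > 0" "v > 0" "\<gamma> * d / v > 0" using False \<gamma> d by (auto simp: v_def)
  have [measurable]: "(\<lambda>z. normal_density (m z) s (y z)) \<in> borel_measurable M"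
    if "m \<in> borel_measurable M" "y \<in> borel_measurable M" for m y :: "'z \<Rightarrow> real" and s M
    using that unfolding normal_density_def by measurable
  have "(\<integral>\<^sup>+ t. \<integral>\<^sup>+ x. f (t, x) \<partial>normal_meas t d \<partial>normal_meas 0 \<gamma>) =
      (\<integral>\<^sup>+ t. \<integral>\<^sup>+ x. ?prior t * ?likelihood t x * f (t, x) \<partial>lborel \<partial>lborel)"
    using pos d by (simp add: normal_meas_def nn_integral_density nn_integral_cmult mult.assoc)
  also have "\<dots> = (\<integral>\<^sup>+ x. \<integral>\<^sup>+ t. ?prior t * ?likelihood t x * f (t, x) \<partial>lborel \<partial>lborel)"
    by (rule lborel_pair.Fubini') measurable
  also have "\<dots> = (\<integral>\<^sup>+ x. \<integral>\<^sup>+ t. ?marginal x * ?posterior x t * f (t, x) \<partial>lborel \<partial>lborel)"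
    using normal_density_conjugate[OF pos(1) d] by (simp add: v_def flip: ennreal_mult')
  also have "\<dots> = (\<integral>\<^sup>+ x. \<integral>\<^sup>+ t. f (t, x) \<partial>normal_meas (\<gamma> / v * x) (\<gamma> * d / v) \<partial>normal_meas 0 v)"
    using pos d by (simp add: normal_meas_def nn_integral_density nn_integral_cmult mult.assoc)
  finally show ?thesis .
qed

lemma distr_swap_gauss_pair:
  assumes \<gamma>: "\<gamma> \<ge> 0" and d: "d > 0"
  defines "v \<equiv> d + \<gamma>"
  shows "distr (gauss_pair v (\<gamma> / v) (\<gamma> * d / v)) (borel \<Otimes>\<^sub>M borel) prod.swap = gauss_pair \<gamma> 1 d"
    (is "distr ?G _ _ = _")
proof (rule measure_eqI)
  fix A assume "A \<in> sets (distr ?G (borel \<Otimes>\<^sub>M borel) prod.swap)"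
  then have [measurable]: "A \<in> sets (borel \<Otimes>\<^sub>M borel)" by simp
  have [measurable]: "prod.swap \<in> (borel \<Otimes>\<^sub>M borel) \<rightarrow>\<^sub>M (borel \<Otimes>\<^sub>M borel :: (real \<times> real) measure)"
    unfolding prod.swap_def by measurable
  have "emeasure (distr ?G (borel \<Otimes>\<^sub>M borel) prod.swap) A = (\<integral>\<^sup>+ z. indicator A (prod.swap z) \<partial>?G)"
    by (simp add: nn_integral_distr flip: nn_integral_indicator)
  also have "\<dots> = (\<integral>\<^sup>+ x. \<integral>\<^sup>+ t. indicator A (t, x) \<partial>normal_meas (\<gamma> / v * x) (\<gamma> * d / v) \<partial>normal_meas 0 v)"
    using \<gamma> d by (subst nn_integral_gauss_pair) (auto simp: v_def)
  also have "\<dots> = (\<integral>\<^sup>+ t. \<integral>\<^sup>+ x. indicator A (t, x) \<partial>normal_meas t d \<partial>normal_meas 0 \<gamma>)"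
    unfolding v_def by (rule nn_integral_normal_bayes[OF \<gamma> d, symmetric]) measurable
  also have "\<dots> = emeasure (gauss_pair \<gamma> 1 d) A"
    using \<gamma> d by (simp add: nn_integral_gauss_pair flip: nn_integral_indicator)
  finally show "emeasure (distr ?G (borel \<Otimes>\<^sub>M borel) prod.swap) A = emeasure (gauss_pair \<gamma> 1 d) A" .
qed simp

lemma distr_std_gauss_pair:
  assumes I: "finite I"
  shows "distr (std_gauss I \<Otimes>\<^sub>M std_gauss I) (PiM I (\<lambda>_. borel \<Otimes>\<^sub>M borel))
      (\<lambda>z. \<lambda>j\<in>I. (sqrt (u j) * fst z j, k j * (sqrt (u j) * fst z j) + sqrt (w j) * snd z j)) =
    PiM I (\<lambda>j. gauss_pair (u j) (k j) (w j))"
proof -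
  let ?S = "std_normal \<Otimes>\<^sub>M std_normal" and ?B = "borel \<Otimes>\<^sub>M borel :: (real \<times> real) measure"
  define T where "T j z = (sqrt (u j) * fst z, k j * (sqrt (u j) * fst z) + sqrt (w j) * snd z)"
    for j and z :: "real \<times> real"
  have T [measurable]: "T j \<in> ?S \<rightarrow>\<^sub>M ?B" for j
    unfolding T_def by measurable
  have "PiM I (\<lambda>j. gauss_pair (u j) (k j) (w j)) = PiM I (\<lambda>j. distr ?S ?B (T j))"
    by (simp add: gauss_pair_def T_def[abs_def])
  also have "\<dots> = distr (PiM I (\<lambda>_. ?S)) (PiM I (\<lambda>_. ?B)) (\<lambda>z. \<lambda>j\<in>I. T j (z j))"
    by (rule distr_PiM_componentwise[symmetric, OF I prob_space_pair T])
      (rule std_normal.prob_space_axioms)+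
  also have "PiM I (\<lambda>_. ?S) =
      distr (std_gauss I \<Otimes>\<^sub>M std_gauss I) (PiM I (\<lambda>_. ?S)) (\<lambda>z. \<lambda>j\<in>I. (fst z j, snd z j))"
    by (rule distr_pair_PiM_zip[symmetric, OF I]) (rule std_normal.prob_space_axioms)+
  also have "distr \<dots> (PiM I (\<lambda>_. ?B)) (\<lambda>z. \<lambda>j\<in>I. T j (z j)) =
      distr (std_gauss I \<Otimes>\<^sub>M std_gauss I) (PiM I (\<lambda>_. ?B)) (\<lambda>z. \<lambda>j\<in>I. T j (fst z j, snd z j))"
    by (subst distr_distr) (auto simp: comp_def intro!: distr_cong)
  finally show ?thesis
    by (simp add: T_def)
qed

lemma nn_integral_gauss_diag_pair:
  assumes u: "\<And>j. j \<in> {1..p} \<Longrightarrow> u j \<ge> 0" and w: "\<And>j. j \<in> {1..p} \<Longrightarrow> w j \<ge> 0"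
    and F [measurable]: "case_prod F \<in> borel_measurable (PiM {1..p} (\<lambda>_. borel) \<Otimes>\<^sub>M PiM {1..p} (\<lambda>_. borel))"
  shows "(\<integral>\<^sup>+ t. \<integral>\<^sup>+ x. F t x \<partial>gauss_diag p (\<lambda>j. k j * t j) w \<partial>gauss_diag p (\<lambda>_. 0) u) =
    (\<integral>\<^sup>+ z. F (\<lambda>j\<in>{1..p}. fst (z j)) (\<lambda>j\<in>{1..p}. snd (z j)) \<partial>PiM {1..p} (\<lambda>j. gauss_pair (u j) (k j) (w j)))"
proof -
  let ?I = "{1..p}" and ?P = "std_gauss {1..p}"
  interpret P: prob_space ?P by (rule prob_space_std_gauss)
  have [measurable_cong]: "sets ?P = sets (PiM ?I (\<lambda>_. borel))"
    by (intro sets_PiM_cong) auto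
  have inner: "(\<integral>\<^sup>+ x. F t x \<partial>gauss_diag p (\<lambda>j. k j * t j) w) =
      (\<integral>\<^sup>+ h. F t (\<lambda>j\<in>?I. k j * t j + sqrt (w j) * h j) \<partial>?P)"
    if "t \<in> space (PiM ?I (\<lambda>_. borel))" for t
    by (rule nn_integral_gauss_diag) (use w measurable_Pair2[OF F that] in auto)
  have "(\<integral>\<^sup>+ t. \<integral>\<^sup>+ x. F t x \<partial>gauss_diag p (\<lambda>j. k j * t j) w \<partial>gauss_diag p (\<lambda>_. 0) u) =
      (\<integral>\<^sup>+ t. \<integral>\<^sup>+ h. F t (\<lambda>j\<in>?I. k j * t j + sqrt (w j) * h j) \<partial>?P \<partial>gauss_diag p (\<lambda>_. 0) u)"
    by (intro nn_integral_cong inner) (simp only: sets_eq_imp_space_eq[OF sets_gauss_diag])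
  also have "\<dots> = (\<integral>\<^sup>+ g. \<integral>\<^sup>+ h. F (\<lambda>j\<in>?I. sqrt (u j) * g j)
      (\<lambda>j\<in>?I. k j * (sqrt (u j) * g j) + sqrt (w j) * h j) \<partial>?P \<partial>?P)"
    by (subst nn_integral_gauss_diag) (use u in \<open>auto simp del: One_nat_def cong: restrict_cong\<close>)
  also have "\<dots> = (\<integral>\<^sup>+ z. F (\<lambda>j\<in>?I. sqrt (u j) * fst z j)
      (\<lambda>j\<in>?I. k j * (sqrt (u j) * fst z j) + sqrt (w j) * snd z j) \<partial>(?P \<Otimes>\<^sub>M ?P))"
    by (subst P.nn_integral_fst[symmetric]) (auto simp del: One_nat_def)
  also have "\<dots> = (\<integral>\<^sup>+ z. F (\<lambda>j\<in>?I. fst (z j)) (\<lambda>j\<in>?I. snd (z j)) \<partial>PiM ?I (\<lambda>j. gauss_pair (u j) (k j) (w j)))"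
    unfolding distr_std_gauss_pair[OF finite_atLeastAtMost, symmetric]
    by (subst nn_integral_distr) (auto simp del: One_nat_def cong: restrict_cong)
  finally show ?thesis .
qed

theorem nn_integral_gauss_diag_bayes:
  fixes F :: "(nat \<Rightarrow> real) \<Rightarrow> (nat \<Rightarrow> real) \<Rightarrow> ennreal"
  assumes \<gamma>: "\<And>j. j \<in> {1..p} \<Longrightarrow> \<gamma> j \<ge> 0" and d: "\<And>j. j \<in> {1..p} \<Longrightarrow> d j > 0"
    and F [measurable]: "case_prod F \<in> borel_measurable (PiM {1..p} (\<lambda>_. borel) \<Otimes>\<^sub>M PiM {1..p} (\<lambda>_. borel))"
  defines "v \<equiv> \<lambda>j. d j + \<gamma> j"
  shows "(\<integral>\<^sup>+ \<theta>. \<integral>\<^sup>+ x. F \<theta> x \<partial>gauss_diag p \<theta> d \<partial>gauss_diag p (\<lambda>_. 0) \<gamma>) =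
    (\<integral>\<^sup>+ x. \<integral>\<^sup>+ \<theta>. F \<theta> x \<partial>gauss_diag p (\<lambda>j. \<gamma> j / v j * x j) (\<lambda>j. \<gamma> j * d j / v j) \<partial>gauss_diag p (\<lambda>_. 0) v)"
proof -
  let ?I = "{1..p}" and ?B = "borel \<Otimes>\<^sub>M borel :: (real \<times> real) measure"
  let ?G = "\<lambda>j. gauss_pair (v j) (\<gamma> j / v j) (\<gamma> j * d j / v j)"
  have [measurable]: "prod.swap \<in> ?B \<rightarrow>\<^sub>M ?B"
    unfolding prod.swap_def by measurable
  have swap: "PiM ?I (\<lambda>j. gauss_pair (\<gamma> j) 1 (d j)) =
      distr (PiM ?I ?G) (PiM ?I (\<lambda>_. ?B)) (\<lambda>z. \<lambda>j\<in>?I. prod.swap (z j))"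
  proof (subst distr_PiM_componentwise)
    show "PiM ?I (\<lambda>j. gauss_pair (\<gamma> j) 1 (d j)) = PiM ?I (\<lambda>j. distr (?G j) ?B prod.swap)"
      unfolding v_def by (intro PiM_cong refl distr_swap_gauss_pair[symmetric] \<gamma> d)
  qed (auto intro: prob_space_gauss_pair)
  have [measurable_cong]: "sets (PiM ?I ?G) = sets (PiM ?I (\<lambda>_. ?B))"
    by (intro sets_PiM_cong) auto
  have "(\<integral>\<^sup>+ \<theta>. \<integral>\<^sup>+ x. F \<theta> x \<partial>gauss_diag p \<theta> d \<partial>gauss_diag p (\<lambda>_. 0) \<gamma>) =
      (\<integral>\<^sup>+ z. F (\<lambda>j\<in>?I. fst (z j)) (\<lambda>j\<in>?I. snd (z j)) \<partial>PiM ?I (\<lambda>j. gauss_pair (\<gamma> j) 1 (d j)))"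
    using nn_integral_gauss_diag_pair[of p \<gamma> d F "\<lambda>_. 1", OF \<gamma> less_imp_le[OF d] F] by simp
  also have "\<dots> = (\<integral>\<^sup>+ z. F (\<lambda>j\<in>?I. snd (z j)) (\<lambda>j\<in>?I. fst (z j)) \<partial>PiM ?I ?G)"
    unfolding swap by (subst nn_integral_distr) (auto simp del: One_nat_def cong: restrict_cong)
  also have "\<dots> = (\<integral>\<^sup>+ x. \<integral>\<^sup>+ \<theta>. F \<theta> x
      \<partial>gauss_diag p (\<lambda>j. \<gamma> j / v j * x j) (\<lambda>j. \<gamma> j * d j / v j) \<partial>gauss_diag p (\<lambda>_. 0) v)"
    by (rule nn_integral_gauss_diag_pair[symmetric, where F="\<lambda>x \<theta>. F \<theta> x"])
      (use \<gamma> d in \<open>auto simp: v_def less_imp_le add_nonneg_nonneg simp del: One_nat_def\<close>)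
  finally show ?thesis .
qed

theorem bayes_risk_eq:
  assumes \<gamma>: "\<And>j. j \<in> {1..p} \<Longrightarrow> \<gamma> j \<ge> 0" and d: "\<And>j. j \<in> {1..p} \<Longrightarrow> d j > 0"
    and [measurable]: "\<And>j. j \<in> {1..p} \<Longrightarrow> (\<lambda>x. \<delta> x j) \<in> borel_measurable (PiM {1..p} (\<lambda>_. borel))"
  defines "v \<equiv> \<lambda>j. d j + \<gamma> j"
  shows "bayes_risk p d \<gamma> \<delta> =
    (\<integral>\<^sup>+ x. ennreal (\<Sum>j\<in>{1..p}. (\<delta> x j - \<gamma> j / v j * x j)\<^sup>2 + \<gamma> j * d j / v j) \<partial>gauss_diag p (\<lambda>_. 0) v)"
proof -
  have "bayes_risk p d \<gamma> \<delta> = (\<integral>\<^sup>+ x. \<integral>\<^sup>+ \<theta>. ennreal (\<Sum>j\<in>{1..p}. (\<delta> x j - \<theta> j)\<^sup>2)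
      \<partial>gauss_diag p (\<lambda>j. \<gamma> j / v j * x j) (\<lambda>j. \<gamma> j * d j / v j) \<partial>gauss_diag p (\<lambda>_. 0) v)"
    unfolding bayes_risk_def v_def by (rule nn_integral_gauss_diag_bayes[OF \<gamma> d]) measurable
  also have "\<dots> = (\<integral>\<^sup>+ x. ennreal (\<Sum>j\<in>{1..p}. (\<delta> x j - \<gamma> j / v j * x j)\<^sup>2 + \<gamma> j * d j / v j)
      \<partial>gauss_diag p (\<lambda>_. 0) v)"
    by (intro nn_integral_cong nn_integral_gauss_diag_sum_sq_diff)
      (use \<gamma> d in \<open>auto simp: v_def less_imp_le\<close>)
  finally show ?thesis .
qed

subsection \<open>Inverse moments of weighted sums of squares\<close>

definition weighted_sum_sq :: "'i set \<Rightarrow> ('i \<Rightarrow> real) \<Rightarrow> ('i \<Rightarrow> real) \<Rightarrow> real" where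
  "weighted_sum_sq I s x = (\<Sum>k\<in>I. s k * (x k)\<^sup>2)"

lemma measurable_weighted_sum_sq [measurable]:
  "weighted_sum_sq I s \<in> borel_measurable (std_gauss I)"
  unfolding weighted_sum_sq_def by measurable

lemma nn_integral_power_mult_exp_neg:
  assumes l: "l > 0"
  shows "(\<integral>\<^sup>+t\<in>{0..}. ennreal (t ^ k * exp (- (t * l))) \<partial>lborel) = ennreal (fact k / l ^ Suc k)"
proof -
  have "(\<integral>\<^sup>+t\<in>{0..}. ennreal (t ^ k * exp (- (t * l))) \<partial>lborel) =
      (\<integral>\<^sup>+t. ennreal (fact k / l ^ Suc k) * ennreal (erlang_density k l t * t ^ 0) \<partial>lborel)"
    using l by (intro nn_integral_cong) (auto simp: erlang_density_def indicator_def simp flip: ennreal_mult')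
  also have "\<dots> = ennreal (fact k / l ^ Suc k)"
    using nn_integral_erlang_ith_moment[OF l, of k 0] by (simp add: nn_integral_cmult del: power_Suc)
  finally show ?thesis .
qed

lemma nn_integral_affine_mult_exp_neg:
  assumes l: "l > 0" and ab: "a \<ge> 0" "b \<ge> 0"
  shows "(\<integral>\<^sup>+t\<in>{0..}. ennreal ((a + b * t) * exp (- (t * l))) \<partial>lborel) = ennreal (a / l + b / l\<^sup>2)"
proof -
  have "(\<integral>\<^sup>+t\<in>{0..}. ennreal ((a + b * t) * exp (- (t * l))) \<partial>lborel) =
      (\<integral>\<^sup>+t. ennreal a * (ennreal (t ^ 0 * exp (- (t * l))) * indicator {0..} t) +
        ennreal b * (ennreal (t ^ 1 * exp (- (t * l))) * indicator {0..} t) \<partial>lborel)"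
    using ab by (intro nn_integral_cong)
      (auto simp: indicator_def algebra_simps simp flip: ennreal_mult' ennreal_plus)
  also have "\<dots> = ennreal a * ennreal (fact 0 / l ^ Suc 0) + ennreal b * ennreal (fact 1 / l ^ Suc 1)"
    by (subst nn_integral_add, measurable, subst (1 2) nn_integral_cmult, measurable)
      (simp only: nn_integral_power_mult_exp_neg[OF l])
  also have "\<dots> = ennreal (a / l + b / l\<^sup>2)"
    using l ab by (simp add: power2_eq_square flip: ennreal_mult' ennreal_plus)
  finally show ?thesis .
qed

lemma nn_integral_std_normal_even_power_exp_neg_sq:
  assumes t: "t \<ge> 0"
  defines "\<sigma> \<equiv> 1 / sqrt (1 + 2 * t)"
  shows "(\<integral>\<^sup>+ y. ennreal (y ^ (2 * m) * exp (- (t * y\<^sup>2))) \<partial>std_normal) =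
    ennreal (\<sigma> * (fact (2 * m) / ((2 / \<sigma>\<^sup>2) ^ m * fact m)))"
proof -
  have \<sigma>: "\<sigma> > 0" "\<sigma>\<^sup>2 = 1 / (1 + 2 * t)" using t by (auto simp: \<sigma>_def power_divide)
  have tilt: "std_normal_density y * exp (- (t * y\<^sup>2)) = \<sigma> * normal_density 0 \<sigma> y" for y
  proof -
    have "std_normal_density y * exp (- (t * y\<^sup>2)) = 1 / sqrt (2 * pi) * exp (- y\<^sup>2 / 2 + - (t * y\<^sup>2))"
      by (simp only: std_normal_density_def exp_add mult.assoc)
    also have "- y\<^sup>2 / 2 + - (t * y\<^sup>2) = - (y - 0)\<^sup>2 / (2 * \<sigma>\<^sup>2)"
      unfolding \<sigma>(2) by (simp add: field_simps)
    also have "1 / sqrt (2 * pi) = \<sigma> * (1 / sqrt (2 * pi * \<sigma>\<^sup>2))"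
      using \<sigma>(1) by (simp add: real_sqrt_mult)
    finally show ?thesis
      by (simp only: normal_density_def mult.assoc)
  qed
  have "(\<integral>\<^sup>+ y. ennreal (y ^ (2 * m) * exp (- (t * y\<^sup>2))) \<partial>std_normal) =
      (\<integral>\<^sup>+ y. ennreal (std_normal_density y * exp (- (t * y\<^sup>2)) * y ^ (2 * m)) \<partial>lborel)"
    unfolding std_normal_def by (simp add: nn_integral_density mult_ac flip: ennreal_mult')
  also have "\<dots> = (\<integral>\<^sup>+ y. ennreal (\<sigma> * (normal_density 0 \<sigma> y * (y - 0) ^ (2 * m))) \<partial>lborel)"
    unfolding tilt by (simp add: mult.assoc)
  also have "\<dots> = ennreal (\<sigma> * (fact (2 * m) / ((2 / \<sigma>\<^sup>2) ^ m * fact m)))"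
    using has_bochner_integral_mult_right[OF normal_moment_even[OF \<sigma>(1)], of \<sigma> 0 m] \<sigma>(1)
    by (intro nn_integral_eq_integral[THEN trans] arg_cong[where f=ennreal])
      (auto simp: has_bochner_integral_iff zero_le_even_power)
  finally show ?thesis .
qed

lemma nn_integral_std_normal_exp_neg_sq:
  "t \<ge> 0 \<Longrightarrow> (\<integral>\<^sup>+ y. ennreal (exp (- (t * y\<^sup>2))) \<partial>std_normal) = ennreal (1 / sqrt (1 + 2 * t))"
  using nn_integral_std_normal_even_power_exp_neg_sq[of t 0] by simp

lemma nn_integral_std_normal_sq_exp_neg_sq:
  assumes t: "t \<ge> 0"
  shows "(\<integral>\<^sup>+ y. ennreal (y\<^sup>2 * exp (- (t * y\<^sup>2))) \<partial>std_normal) =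
    ennreal (1 / (1 + 2 * t) * (1 / sqrt (1 + 2 * t)))"
proof -
  have "fact (2 * 1) / ((2 / (1 / sqrt (1 + 2 * t))\<^sup>2) ^ 1 * fact 1) = 1 / (1 + 2 * t)"
    using t by (simp add: power_divide divide_simps)
  from nn_integral_std_normal_even_power_exp_neg_sq[OF t, of 1, unfolded this]
  show ?thesis by (simp add: mult.commute)
qed

locale positive_weights =
  fixes I :: "'i set" and s :: "'i \<Rightarrow> real"
  assumes finite: "finite I" and nonempty: "I \<noteq> {}" and pos: "\<And>k. k \<in> I \<Longrightarrow> s k > 0"
begin

abbreviation "S \<equiv> weighted_sum_sq I s"

sublocale prob_space "std_gauss I"
  by (rule prob_space_std_gauss)

sublocale gauss_lborel: pair_sigma_finite "std_gauss I" lborel ..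

lemma sum_sq_nonneg: "S x \<ge> 0"
  unfolding weighted_sum_sq_def by (intro sum_nonneg mult_nonneg_nonneg less_imp_le[OF pos]) auto

lemma AE_sum_sq_pos: "AE x in std_gauss I. S x > 0"
proof -
  obtain j where j: "j \<in> I" using nonempty by auto
  have "AE y in lborel. y \<noteq> (0::real)" by (rule AE_lborel_singleton)
  then have "AE y in std_normal. y \<noteq> 0"
    unfolding std_normal_def by (subst AE_density) auto
  then have "AE x in std_gauss I. x j \<noteq> 0"
    by (intro AE_PiM_component[where P="\<lambda>y. y \<noteq> 0"] std_normal.prob_space_axioms j)
  then show ?thesis
  proof eventually_elim
    case (elim x)
    with pos[OF j] have "0 < s j * (x j)\<^sup>2" by simp
    then show ?case
      unfolding weighted_sum_sq_def using finite j pos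
      by (intro sum_pos2[of I j]) (auto simp: less_imp_le)
  qed
qed

lemma one_plus_weight_pos: "t \<ge> 0 \<Longrightarrow> k \<in> I \<Longrightarrow> 1 + 2 * t * s k > 0"
  using pos[of k] by (simp add: add_pos_nonneg)

lemma exp_neg_sum_sq: "exp (- (t * S x)) = (\<Prod>k\<in>I. exp (- (t * s k * (x k)\<^sup>2)))"
  unfolding weighted_sum_sq_def exp_sum[OF finite, symmetric]
  by (simp add: sum_distrib_left sum_negf mult.assoc)

lemma nn_integral_exp_neg_sum_sq:
  assumes t: "t \<ge> 0"
  shows "(\<integral>\<^sup>+ x. ennreal (exp (- (t * S x))) \<partial>std_gauss I) = ennreal (\<Prod>k\<in>I. 1 / sqrt (1 + 2 * t * s k))"
proof -
  have "(\<integral>\<^sup>+ x. ennreal (exp (- (t * S x))) \<partial>std_gauss I) =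
      (\<integral>\<^sup>+ x. (\<Prod>k\<in>I. ennreal (exp (- (t * s k * (x k)\<^sup>2)))) \<partial>std_gauss I)"
    unfolding exp_neg_sum_sq by (subst prod_ennreal) auto
  also have "\<dots> = (\<Prod>k\<in>I. \<integral>\<^sup>+ y. ennreal (exp (- (t * s k * y\<^sup>2))) \<partial>std_normal)"
    by (rule std_gauss.product_nn_integral_prod[OF finite]) measurable
  also have "\<dots> = (\<Prod>k\<in>I. ennreal (1 / sqrt (1 + 2 * t * s k)))"
  proof (intro prod.cong refl)
    fix k assume "k \<in> I"
    then show "(\<integral>\<^sup>+ y. ennreal (exp (- (t * s k * y\<^sup>2))) \<partial>std_normal) = ennreal (1 / sqrt (1 + 2 * t * s k))"
      using nn_integral_std_normal_exp_neg_sq[of "t * s k"] t pos[of k] by (simp add: mult.assoc)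
  qed
  also have "\<dots> = ennreal (\<Prod>k\<in>I. 1 / sqrt (1 + 2 * t * s k))"
    by (rule prod_ennreal) (use one_plus_weight_pos[OF t] in \<open>auto simp: less_imp_le\<close>)
  finally show ?thesis .
qed

lemma nn_integral_sq_exp_neg_sum_sq:
  assumes t: "t \<ge> 0" and j: "j \<in> I"
  shows "(\<integral>\<^sup>+ x. ennreal ((x j)\<^sup>2 * exp (- (t * S x))) \<partial>std_gauss I) =
    ennreal (1 / (1 + 2 * t * s j)) * (\<integral>\<^sup>+ x. ennreal (exp (- (t * S x))) \<partial>std_gauss I)"
proof -
  define f where "f k y = ennreal ((if k = j then y\<^sup>2 else 1) * exp (- (t * s k * y\<^sup>2)))" for k y
  define q where "q k = (if k = j then 1 / (1 + 2 * t * s k) else 1)" for k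
  have [measurable]: "f k \<in> borel_measurable borel" for k
    unfolding f_def by measurable
  have prod_single: "(\<Prod>k\<in>I. if k = j then c k else 1) = c j" for c :: "'i \<Rightarrow> real"
    using finite j by simp
  have factor: "(\<integral>\<^sup>+ y. f k y \<partial>std_normal) = ennreal (q k * (1 / sqrt (1 + 2 * t * s k)))" if "k \<in> I" for k
    using nn_integral_std_normal_exp_neg_sq[of "t * s k"] nn_integral_std_normal_sq_exp_neg_sq[of "t * s k"]
      t pos[OF that] by (cases "k = j") (simp_all add: f_def q_def mult.assoc)
  have "(\<integral>\<^sup>+ x. ennreal ((x j)\<^sup>2 * exp (- (t * S x))) \<partial>std_gauss I) =
      (\<integral>\<^sup>+ x. (\<Prod>k\<in>I. f k (x k)) \<partial>std_gauss I)"
    unfolding exp_neg_sum_sq f_def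
    by (subst prod_ennreal) (auto simp: prod.distrib prod_single)
  also have "\<dots> = (\<Prod>k\<in>I. \<integral>\<^sup>+ y. f k y \<partial>std_normal)"
    by (rule std_gauss.product_nn_integral_prod[OF finite]) measurable
  also have "\<dots> = ennreal (\<Prod>k\<in>I. q k * (1 / sqrt (1 + 2 * t * s k)))"
    using one_plus_weight_pos[OF t]
    by (subst prod_ennreal[symmetric]) (auto simp: factor q_def less_imp_le)
  also have "\<dots> = ennreal (1 / (1 + 2 * t * s j)) * ennreal (\<Prod>k\<in>I. 1 / sqrt (1 + 2 * t * s k))"
    unfolding prod.distrib q_def prod_single
    by (rule ennreal_mult') (use one_plus_weight_pos[OF t j] in simp)
  finally show ?thesis
    by (simp only: nn_integral_exp_neg_sum_sq[OF t])
qed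

lemma nn_integral_stein_exp_neg_sum_sq:
  assumes t: "t \<ge> 0" and j: "j \<in> I"
  shows "(\<integral>\<^sup>+ x. ennreal (((x j)\<^sup>2 + 2 * s j * (x j)\<^sup>2 * t) * exp (- (t * S x))) \<partial>std_gauss I) =
    (\<integral>\<^sup>+ x. ennreal (exp (- (t * S x))) \<partial>std_gauss I)"
proof -
  note weight_pos = one_plus_weight_pos[OF t j]
  have "(\<integral>\<^sup>+ x. ennreal (((x j)\<^sup>2 + 2 * s j * (x j)\<^sup>2 * t) * exp (- (t * S x))) \<partial>std_gauss I) =
      (\<integral>\<^sup>+ x. ennreal (1 + 2 * t * s j) * ennreal ((x j)\<^sup>2 * exp (- (t * S x))) \<partial>std_gauss I)"
    using weight_pos by (simp add: algebra_simps flip: ennreal_mult')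
  also have "\<dots> = ennreal (1 + 2 * t * s j) * (\<integral>\<^sup>+ x. ennreal ((x j)\<^sup>2 * exp (- (t * S x))) \<partial>std_gauss I)"
    using j by (intro nn_integral_cmult) measurable
  also have "\<dots> = (\<integral>\<^sup>+ x. ennreal (exp (- (t * S x))) \<partial>std_gauss I)"
    unfolding nn_integral_sq_exp_neg_sum_sq[OF t j]
    using weight_pos by (simp add: mult.assoc[symmetric] flip: ennreal_mult')
  finally show ?thesis .
qed

lemma nn_integral_inverse_sum_sq_laplace:
  "(\<integral>\<^sup>+ x. ennreal (1 / S x) \<partial>std_gauss I) =
    (\<integral>\<^sup>+t\<in>{0..}. (\<integral>\<^sup>+ x. ennreal (exp (- (t * S x))) \<partial>std_gauss I) \<partial>lborel)"
proof -
  have "(\<integral>\<^sup>+ x. ennreal (1 / S x) \<partial>std_gauss I) =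
      (\<integral>\<^sup>+ x. (\<integral>\<^sup>+t\<in>{0..}. ennreal (exp (- (t * S x))) \<partial>lborel) \<partial>std_gauss I)"
    using AE_sum_sq_pos
  proof (intro nn_integral_cong_AE, eventually_elim)
    case (elim x)
    then show ?case using nn_integral_power_mult_exp_neg[of "S x" 0] by simp
  qed
  also have "\<dots> = (\<integral>\<^sup>+t\<in>{0..}. (\<integral>\<^sup>+ x. ennreal (exp (- (t * S x))) \<partial>std_gauss I) \<partial>lborel)"
    by (subst gauss_lborel.Fubini'[symmetric]) (auto simp: nn_integral_multc)
  finally show ?thesis .
qed

lemma nn_integral_inverse_sum_sq:
  "(\<integral>\<^sup>+ x. ennreal (1 / S x) \<partial>std_gauss I) =
    (\<integral>\<^sup>+t\<in>{0..}. ennreal (\<Prod>k\<in>I. 1 / sqrt (1 + 2 * t * s k)) \<partial>lborel)"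
  unfolding nn_integral_inverse_sum_sq_laplace
  by (intro nn_integral_cong) (simp add: nn_integral_exp_neg_sum_sq indicator_def)

lemma nn_integral_stein_sum_sq:
  assumes j: "j \<in> I"
  shows "(\<integral>\<^sup>+ x. ennreal ((x j)\<^sup>2 / S x + 2 * s j * (x j)\<^sup>2 / (S x)\<^sup>2) \<partial>std_gauss I) =
    (\<integral>\<^sup>+ x. ennreal (1 / S x) \<partial>std_gauss I)"
proof -
  let ?f = "\<lambda>x t. ennreal (((x j)\<^sup>2 + 2 * s j * (x j)\<^sup>2 * t) * exp (- (t * S x)))"
  have "(\<integral>\<^sup>+ x. ennreal ((x j)\<^sup>2 / S x + 2 * s j * (x j)\<^sup>2 / (S x)\<^sup>2) \<partial>std_gauss I) =
      (\<integral>\<^sup>+ x. (\<integral>\<^sup>+t\<in>{0..}. ?f x t \<partial>lborel) \<partial>std_gauss I)"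
    using AE_sum_sq_pos by (intro nn_integral_cong_AE, eventually_elim)
      (use pos[OF j] in \<open>simp add: nn_integral_affine_mult_exp_neg\<close>)
  also have "\<dots> = (\<integral>\<^sup>+t\<in>{0..}. (\<integral>\<^sup>+ x. ?f x t \<partial>std_gauss I) \<partial>lborel)"
    using j by (subst gauss_lborel.Fubini'[symmetric]) (auto simp: nn_integral_multc)
  also have "\<dots> = (\<integral>\<^sup>+t\<in>{0..}. (\<integral>\<^sup>+ x. ennreal (exp (- (t * S x))) \<partial>std_gauss I) \<partial>lborel)"
    by (intro nn_integral_cong) (simp add: nn_integral_stein_exp_neg_sum_sq[OF _ j] indicator_def)
  also have "\<dots> = (\<integral>\<^sup>+ x. ennreal (1 / S x) \<partial>std_gauss I)"
    by (rule nn_integral_inverse_sum_sq_laplace[symmetric])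
  finally show ?thesis .
qed

end

lemma nn_integral_affine_powr_neg:
  fixes b q :: real
  assumes b: "b > 0" and q: "q > 1"
  shows "(\<integral>\<^sup>+t\<in>{0..}. ennreal ((1 + b * t) powr (- q)) \<partial>lborel) = ennreal (1 / ((q - 1) * b))"
proof -
  define F where "F t = - ((1 + b * t) powr (1 - q) / ((q - 1) * b))" for t
  have "(\<integral>\<^sup>+t\<in>{0..}. ennreal ((1 + b * t) powr (- q)) \<partial>lborel) = ennreal (0 - F 0)"
  proof (rule nn_integral_FTC_atLeast)
    fix t :: real assume "t \<ge> 0"
    then have "1 + b * t > 0" using b by (simp add: add_pos_nonneg)
    then have "((\<lambda>t. (1 + b * t) powr (1 - q)) has_real_derivative
        (1 - q) * b * (1 + b * t) powr (- q)) (at t)"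
      by (auto intro!: derivative_eq_intros)
    from DERIV_minus[OF DERIV_cdivide[OF this, of "(q - 1) * b"]]
    show "(F has_real_derivative (1 + b * t) powr (- q)) (at t)"
      unfolding F_def by (rule DERIV_cong) (use b q in \<open>simp add: divide_simps algebra_simps\<close>)
  next
    have "filterlim (\<lambda>t. 1 + b * t) at_top at_top"
      by (intro filterlim_tendsto_add_at_top[OF tendsto_const] filterlim_ident
        filterlim_tendsto_pos_mult_at_top[OF tendsto_const b])
    then have "((\<lambda>t. (1 + b * t) powr (1 - q)) \<longlongrightarrow> 0) at_top"
      using q by (intro tendsto_neg_powr) auto
    from tendsto_minus[OF tendsto_divide[OF this tendsto_const]]
    show "(F \<longlongrightarrow> 0) at_top"
      unfolding F_def using b q by force
  qed auto
  then show ?thesis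
    by (simp add: F_def)
qed

lemma prod_le_mean_powr:
  fixes x :: "'a \<Rightarrow> real"
  assumes I: "finite I" "I \<noteq> {}" and x: "\<And>i. i \<in> I \<Longrightarrow> x i \<ge> 0"
  shows "(\<Prod>i\<in>I. x i) \<le> ((\<Sum>i\<in>I. x i) / card I) powr card I"
proof -
  have nonneg: "(\<Prod>i\<in>I. x i) \<ge> 0" using x by (rule prod_nonneg)
  have "(\<Prod>i\<in>I. x i) = ((\<Prod>i\<in>I. x i) powr (1 / card I)) powr card I"
    using I nonneg by (simp add: powr_powr)
  also have "\<dots> \<le> ((\<Sum>i\<in>I. x i) / card I) powr card I"
    using arith_geom_mean[OF I x] by (intro powr_mono2) (auto simp: sum_divide_distrib)
  finally show ?thesis .
qed

lemma prod_inverse_sqrt_eq_powr: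
  fixes f :: "'a \<Rightarrow> real"
  assumes "\<And>k. k \<in> I \<Longrightarrow> f k \<ge> 0"
  shows "(\<Prod>k\<in>I. 1 / sqrt (f k)) = (\<Prod>k\<in>I. f k) powr (- (1/2))"
proof -
  have "(\<Prod>k\<in>I. f k) powr (- (1/2)) = (\<Prod>k\<in>I. f k powr (- (1/2)))"
    by (rule prod_powr_distrib)
  also have "\<dots> = (\<Prod>k\<in>I. 1 / sqrt (f k))"
    by (intro prod.cong refl) (use assms in \<open>auto simp: powr_minus_divide powr_half_sqrt\<close>)
  finally show ?thesis ..
qed

context positive_weights
begin

lemma prod_inverse_sqrt_le:
  assumes m: "m > 0" "\<And>k. k \<in> I \<Longrightarrow> m \<le> s k" and t: "t \<ge> 0"
  shows "(\<Prod>k\<in>I. 1 / sqrt (1 + 2 * t * s k)) \<le> (1 + 2 * m * t) powr (- (card I / 2))"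
proof -
  have m_pos: "1 + 2 * m * t > 0" using m t by (simp add: add_pos_nonneg)
  have "1 + 2 * m * t \<le> 1 + 2 * t * s k" if "k \<in> I" for k
    using mult_left_mono[OF m(2)[OF that] t] by (simp add: mult.commute)
  with m_pos have "(\<Prod>k\<in>I. 1 / sqrt (1 + 2 * t * s k)) \<le> (\<Prod>k\<in>I. 1 / sqrt (1 + 2 * m * t))"
    by (intro prod_mono conjI frac_le real_sqrt_le_mono) (auto intro: order_trans[OF less_imp_le])
  also have "\<dots> = (1 + 2 * m * t) powr (- (card I / 2))"
    using m_pos by (subst prod_inverse_sqrt_eq_powr) (auto simp: powr_powr simp flip: powr_realpow)
  finally show ?thesis .
qed

lemma prod_inverse_sqrt_ge:
  assumes t: "t \<ge> 0"
  defines "mean \<equiv> (\<Sum>k\<in>I. s k) / card I"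
  shows "(1 + 2 * mean * t) powr (- (card I / 2)) \<le> (\<Prod>k\<in>I. 1 / sqrt (1 + 2 * t * s k))"
proof -
  note weight_pos = one_plus_weight_pos[OF t]
  have "(\<Sum>k\<in>I. 1 + 2 * t * s k) / card I = 1 + 2 * mean * t"
    using finite nonempty by (simp add: mean_def sum.distrib sum_distrib_left[symmetric] add_divide_distrib)
  with prod_le_mean_powr[OF finite nonempty, of "\<lambda>k. 1 + 2 * t * s k"] weight_pos
  have "(\<Prod>k\<in>I. 1 + 2 * t * s k) \<le> (1 + 2 * mean * t) powr card I"
    by (simp add: less_imp_le)
  then have "((1 + 2 * mean * t) powr card I) powr (- (1/2)) \<le> (\<Prod>k\<in>I. 1 + 2 * t * s k) powr (- (1/2))"
    using weight_pos by (intro powr_mono2') (auto intro: prod_pos)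
  then show ?thesis
    using weight_pos by (simp add: prod_inverse_sqrt_eq_powr powr_powr less_imp_le)
qed

end

locale positive_weights_ge3 = positive_weights I s for I :: "'i set" and s +
  assumes card_ge: "card I \<ge> 3"
begin

lemma integrable_inverse_sum_sq: "integrable (std_gauss I) (\<lambda>x. 1 / S x)"
proof (rule integrableI_nonneg)
  define m where "m = Min (s ` I)"
  have m: "m > 0" "\<And>k. k \<in> I \<Longrightarrow> m \<le> s k"
    using finite nonempty pos by (auto simp: m_def)
  have "(\<integral>\<^sup>+ x. ennreal (1 / S x) \<partial>std_gauss I) \<le>
      (\<integral>\<^sup>+t\<in>{0..}. ennreal ((1 + 2 * m * t) powr (- (card I / 2))) \<partial>lborel)"
    unfolding nn_integral_inverse_sum_sq
    by (intro nn_integral_mono) (use prod_inverse_sqrt_le[OF m] in \<open>simp add: ennreal_leI indicator_def\<close>)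
  also have "\<dots> = ennreal (1 / ((card I / 2 - 1) * (2 * m)))"
    by (rule nn_integral_affine_powr_neg) (use m card_ge in auto)
  finally show "(\<integral>\<^sup>+ x. ennreal (1 / S x) \<partial>std_gauss I) < \<infinity>"
    by (rule le_less_trans) simp
qed (simp_all add: sum_sq_nonneg)

lemma nn_integral_inverse_sum_sq_eq_integral:
  "(\<integral>\<^sup>+ x. ennreal (1 / S x) \<partial>std_gauss I) = ennreal (\<integral>x. 1 / S x \<partial>std_gauss I)"
  by (rule nn_integral_eq_integral[OF integrable_inverse_sum_sq]) (simp add: sum_sq_nonneg)

lemma integral_inverse_sum_sq_ge:
  "real (card I) / ((real (card I) - 2) * (\<Sum>k\<in>I. s k)) \<le> (\<integral>x. 1 / S x \<partial>std_gauss I)"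
proof -
  define mean where "mean = (\<Sum>k\<in>I. s k) / card I"
  have mean: "mean > 0"
    unfolding mean_def using finite nonempty pos by (intro divide_pos_pos sum_pos) (auto simp: card_gt_0_iff)
  have "ennreal (1 / ((card I / 2 - 1) * (2 * mean))) =
      (\<integral>\<^sup>+t\<in>{0..}. ennreal ((1 + 2 * mean * t) powr (- (card I / 2))) \<partial>lborel)"
    by (rule nn_integral_affine_powr_neg[symmetric]) (use mean card_ge in auto)
  also have "\<dots> \<le> (\<integral>\<^sup>+ x. ennreal (1 / S x) \<partial>std_gauss I)"
    unfolding nn_integral_inverse_sum_sq
    by (intro nn_integral_mono) (use prod_inverse_sqrt_ge in \<open>simp add: mean_def ennreal_leI indicator_def\<close>)
  finally have "1 / ((card I / 2 - 1) * (2 * mean)) \<le> (\<integral>x. 1 / S x \<partial>std_gauss I)"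
    by (simp add: nn_integral_inverse_sum_sq_eq_integral ennreal_le_iff integral_nonneg sum_sq_nonneg)
  moreover have "(card I / 2 - 1) * (2 * mean) = (real (card I) - 2) * (\<Sum>k\<in>I. s k) / card I"
    by (simp add: mean_def left_diff_distrib diff_divide_distrib)
  ultimately show ?thesis by simp
qed

lemma
  assumes j: "j \<in> I"
  shows integrable_sq_div_sum_sq: "integrable (std_gauss I) (\<lambda>x. (x j)\<^sup>2 / S x)"
    and integrable_sq_div_sum_sq_sq: "integrable (std_gauss I) (\<lambda>x. s j * (x j)\<^sup>2 / (S x)\<^sup>2)"
    and integral_stein_sum_sq: "(\<integral>x. (x j)\<^sup>2 / S x \<partial>std_gauss I) =
      (\<integral>x. 1 / S x \<partial>std_gauss I) - 2 * (\<integral>x. s j * (x j)\<^sup>2 / (S x)\<^sup>2 \<partial>std_gauss I)"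
proof -
  let ?f = "\<lambda>x. (x j)\<^sup>2 / S x" and ?g = "\<lambda>x. s j * (x j)\<^sup>2 / (S x)\<^sup>2"
  have [measurable]: "(\<lambda>x. x j) \<in> borel_measurable (std_gauss I)"
    using j by measurable
  have nonneg: "?f x \<ge> 0" "?g x \<ge> 0" for x
    using sum_sq_nonneg pos[OF j] by simp_all
  have nonneg_sum: "?f x + 2 * ?g x \<ge> 0" for x
    using nonneg[of x] by linarith
  have total: "(\<integral>\<^sup>+ x. ennreal (?f x + 2 * ?g x) \<partial>std_gauss I) = ennreal (\<integral>x. 1 / S x \<partial>std_gauss I)"
    using nn_integral_stein_sum_sq[OF j] by (simp add: nn_integral_inverse_sum_sq_eq_integral mult.assoc)
  have sum: "integrable (std_gauss I) (\<lambda>x. ?f x + 2 * ?g x)"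
    by (rule integrableI_nonneg, measurable)
      (simp_all only: nonneg_sum total AE_I2 ennreal_less_top infinity_ennreal_def)
  have le_sum: "norm (?f x) \<le> norm (?f x + 2 * ?g x)" "norm (?g x) \<le> norm (?f x + 2 * ?g x)" for x
    using nonneg[of x] unfolding real_norm_def by linarith+
  show integrable_f: "integrable (std_gauss I) ?f" and integrable_g: "integrable (std_gauss I) ?g"
    by (rule Bochner_Integration.integrable_bound[OF sum _ AE_I2[OF le_sum(1)]], measurable)
      (rule Bochner_Integration.integrable_bound[OF sum _ AE_I2[OF le_sum(2)]], measurable)
  have "(\<integral>x. ?f x + 2 * ?g x \<partial>std_gauss I) = (\<integral>x. 1 / S x \<partial>std_gauss I)"
    using trans[OF nn_integral_eq_integral[OF sum AE_I2[OF nonneg_sum], symmetric] total]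
    by (simp only: ennreal_inj Bochner_Integration.integral_nonneg nonneg_sum sum_sq_nonneg zero_le_divide_1_iff)
  moreover have "(\<integral>x. ?f x + 2 * ?g x \<partial>std_gauss I) = (\<integral>x. ?f x \<partial>std_gauss I) + 2 * (\<integral>x. ?g x \<partial>std_gauss I)"
    by (simp only: integral_mult_right_zero
      Bochner_Integration.integral_add[OF integrable_f integrable_mult_right[OF integrable_g]])
  ultimately show "(\<integral>x. ?f x \<partial>std_gauss I) = (\<integral>x. 1 / S x \<partial>std_gauss I) - 2 * (\<integral>x. ?g x \<partial>std_gauss I)"
    by linarith
qed

lemma integral_weighted_sq_div_sum_sq_ge:
  assumes b: "\<And>j. j \<in> I \<Longrightarrow> b j \<le> B"
  shows "((\<Sum>j\<in>I. b j) - 2 * B) * (\<integral>x. 1 / S x \<partial>std_gauss I) \<le>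
    (\<integral>x. (\<Sum>j\<in>I. b j * ((x j)\<^sup>2 / S x)) \<partial>std_gauss I)"
proof -
  let ?E = "\<integral>x. 1 / S x \<partial>std_gauss I" and ?q = "\<lambda>j. \<integral>x. s j * (x j)\<^sup>2 / (S x)\<^sup>2 \<partial>std_gauss I"
  have sum_q: "(\<Sum>j\<in>I. ?q j) = ?E"
  proof -
    have "(\<Sum>j\<in>I. s j * (x j)\<^sup>2 / (S x)\<^sup>2) = S x / (S x)\<^sup>2" for x
      by (simp only: weighted_sum_sq_def sum_divide_distrib)
    then have "(\<Sum>j\<in>I. s j * (x j)\<^sup>2 / (S x)\<^sup>2) = 1 / S x" for x
      by (simp add: power2_eq_square)
    then show ?thesis
      by (subst Bochner_Integration.integral_sum[symmetric]) (auto intro: integrable_sq_div_sum_sq_sq)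
  qed
  have "((\<Sum>j\<in>I. b j) - 2 * B) * ?E = (\<Sum>j\<in>I. b j) * ?E - 2 * (\<Sum>j\<in>I. B * ?q j)"
    by (simp add: left_diff_distrib sum_q flip: sum_distrib_left)
  also have "\<dots> \<le> (\<Sum>j\<in>I. b j) * ?E - 2 * (\<Sum>j\<in>I. b j * ?q j)"
    using b
    by (intro diff_left_mono mult_left_mono sum_mono mult_right_mono Bochner_Integration.integral_nonneg)
      (auto intro!: divide_nonneg_nonneg mult_nonneg_nonneg less_imp_le[OF pos])
  also have "\<dots> = (\<Sum>j\<in>I. b j * (?E - 2 * ?q j))"
    by (simp add: right_diff_distrib sum_subtractf sum_distrib_left sum_distrib_right mult_ac)
  also have "\<dots> = (\<Sum>j\<in>I. b j * (\<integral>x. (x j)\<^sup>2 / S x \<partial>std_gauss I))"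
    by (intro sum.cong refl) (simp only: integral_stein_sum_sq)
  also have "\<dots> = (\<integral>x. (\<Sum>j\<in>I. b j * ((x j)\<^sup>2 / S x)) \<partial>std_gauss I)"
    by (subst Bochner_Integration.integral_sum)
      (auto simp del: times_divide_eq_right intro!: integrable_sq_div_sum_sq)
  finally show ?thesis .
qed

end

subsection \<open>The Bayes risk of the shrinkage estimator\<close>

locale shrinkage =
  fixes I :: "'i set" and \<alpha> \<beta> :: "'i \<Rightarrow> real" and B :: real
  assumes finite_index: "finite I" and card_index: "card I \<ge> 3"
    and \<beta>_nonzero: "\<And>j. j \<in> I \<Longrightarrow> \<beta> j \<noteq> 0"
    and \<alpha>\<beta>_le: "\<And>j. j \<in> I \<Longrightarrow> \<alpha> j * \<beta> j \<le> B"
    and sum_\<alpha>\<beta>_ge: "(\<Sum>j\<in>I. \<alpha> j * \<beta> j) \<ge> 2 * B"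
begin

sublocale positive_weights_ge3 I "\<lambda>j. (\<beta> j)\<^sup>2"
  by unfold_locales (use finite_index card_index \<beta>_nonzero in auto)

definition factor :: real where
  "factor = (\<Sum>j\<in>I. \<alpha> j * \<beta> j) - 2 * B"

definition loss :: "('i \<Rightarrow> real) \<Rightarrow> real" where
  "loss x = (\<Sum>j\<in>I. (\<alpha> j * x j - factor / S x * (\<beta> j * x j))\<^sup>2)"

lemma loss_eq:
  "loss x = (\<Sum>j\<in>I. (\<alpha> j)\<^sup>2 * (x j)\<^sup>2) - 2 * factor * (\<Sum>j\<in>I. \<alpha> j * \<beta> j * ((x j)\<^sup>2 / S x)) + factor\<^sup>2 * (1 / S x)"
proof -
  have "loss x = (\<Sum>j\<in>I. (\<alpha> j)\<^sup>2 * (x j)\<^sup>2 - 2 * factor * (\<alpha> j * \<beta> j * ((x j)\<^sup>2 / S x))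
      + (factor / S x)\<^sup>2 * ((\<beta> j)\<^sup>2 * (x j)\<^sup>2))"
    unfolding loss_def by (intro sum.cong refl) (simp add: power2_eq_square algebra_simps)
  also have "\<dots> = (\<Sum>j\<in>I. (\<alpha> j)\<^sup>2 * (x j)\<^sup>2) - 2 * factor * (\<Sum>j\<in>I. \<alpha> j * \<beta> j * ((x j)\<^sup>2 / S x)) + (factor / S x)\<^sup>2 * S x"
    by (simp only: sum.distrib sum_subtractf sum_distrib_left weighted_sum_sq_def)
  also have "(factor / S x)\<^sup>2 * S x = factor\<^sup>2 * (1 / S x)"
    by (simp add: power2_eq_square)
  finally show ?thesis .
qed

lemma
  shows integrable_loss: "integrable (std_gauss I) loss"
    and integral_loss: "(\<integral>x. loss x \<partial>std_gauss I) = (\<Sum>j\<in>I. (\<alpha> j)\<^sup>2)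
      - 2 * factor * (\<integral>x. (\<Sum>j\<in>I. \<alpha> j * \<beta> j * ((x j)\<^sup>2 / S x)) \<partial>std_gauss I)
      + factor\<^sup>2 * (\<integral>x. 1 / S x \<partial>std_gauss I)"
proof -
  have quadratic: "integrable (std_gauss I) (\<lambda>x. \<Sum>j\<in>I. (\<alpha> j)\<^sup>2 * (x j)\<^sup>2)"
    by (intro Bochner_Integration.integrable_sum integrable_mult_right integrable_std_gauss_square)
  have cross: "integrable (std_gauss I) (\<lambda>x. 2 * factor * (\<Sum>j\<in>I. \<alpha> j * \<beta> j * ((x j)\<^sup>2 / S x)))"
    by (intro Bochner_Integration.integrable_sum integrable_mult_right integrable_sq_div_sum_sq)
  have inverse: "integrable (std_gauss I) (\<lambda>x. factor\<^sup>2 * (1 / S x))"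
    by (intro integrable_mult_right integrable_inverse_sum_sq)
  note diff = Bochner_Integration.integrable_diff[OF quadratic cross]
  have "(\<integral>x. (\<Sum>j\<in>I. (\<alpha> j)\<^sup>2 * (x j)\<^sup>2) \<partial>std_gauss I) = (\<Sum>j\<in>I. (\<alpha> j)\<^sup>2)"
    by (subst Bochner_Integration.integral_sum) (auto simp: integrable_std_gauss_square integral_std_gauss_square)
  then show "(\<integral>x. loss x \<partial>std_gauss I) = (\<Sum>j\<in>I. (\<alpha> j)\<^sup>2)
      - 2 * factor * (\<integral>x. (\<Sum>j\<in>I. \<alpha> j * \<beta> j * ((x j)\<^sup>2 / S x)) \<partial>std_gauss I)
      + factor\<^sup>2 * (\<integral>x. 1 / S x \<partial>std_gauss I)"
    by (simp only: loss_eq Bochner_Integration.integral_add[OF diff inverse]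
      Bochner_Integration.integral_diff[OF quadratic cross] integral_mult_right_zero)
  show "integrable (std_gauss I) loss"
    unfolding loss_eq[abs_def] by (rule Bochner_Integration.integrable_add[OF diff inverse])
qed

lemma integral_loss_le:
  "(\<integral>x. loss x \<partial>std_gauss I) \<le>
    (\<Sum>j\<in>I. (\<alpha> j)\<^sup>2) - factor\<^sup>2 * (real (card I) / ((real (card I) - 2) * (\<Sum>j\<in>I. (\<beta> j)\<^sup>2)))"
proof -
  let ?E = "\<integral>x. 1 / S x \<partial>std_gauss I"
  have "factor * ?E \<le> (\<integral>x. (\<Sum>j\<in>I. \<alpha> j * \<beta> j * ((x j)\<^sup>2 / S x)) \<partial>std_gauss I)"
    unfolding factor_def by (rule integral_weighted_sq_div_sum_sq_ge[OF \<alpha>\<beta>_le])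
  then have "(\<integral>x. loss x \<partial>std_gauss I) \<le> (\<Sum>j\<in>I. (\<alpha> j)\<^sup>2) - 2 * factor * (factor * ?E) + factor\<^sup>2 * ?E"
    unfolding integral_loss using sum_\<alpha>\<beta>_ge
    by (intro add_right_mono diff_left_mono mult_left_mono) (auto simp: factor_def)
  also have "\<dots> = (\<Sum>j\<in>I. (\<alpha> j)\<^sup>2) - factor\<^sup>2 * ?E"
    by (simp add: power2_eq_square)
  also have "\<dots> \<le> (\<Sum>j\<in>I. (\<alpha> j)\<^sup>2) - factor\<^sup>2 * (real (card I) / ((real (card I) - 2) * (\<Sum>j\<in>I. (\<beta> j)\<^sup>2)))"
    by (intro diff_left_mono mult_left_mono integral_inverse_sum_sq_ge) simp
  finally show ?thesis .
qed

lemma nn_integral_loss_plus_const_le: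
  assumes "w \<ge> 0"
  shows "(\<integral>\<^sup>+ x. ennreal (loss x + w) \<partial>std_gauss I) \<le>
    ennreal ((\<Sum>j\<in>I. (\<alpha> j)\<^sup>2) + w - factor\<^sup>2 * (real (card I) / ((real (card I) - 2) * (\<Sum>j\<in>I. (\<beta> j)\<^sup>2))))"
proof -
  have "(\<integral>\<^sup>+ x. ennreal (loss x + w) \<partial>std_gauss I) = ennreal (\<integral>x. loss x + w \<partial>std_gauss I)"
    using assms
    by (intro nn_integral_eq_integral Bochner_Integration.integrable_add integrable_loss integrable_const)
      (simp add: loss_def sum_nonneg)
  also have "(\<integral>x. loss x + w \<partial>std_gauss I) = (\<integral>x. loss x \<partial>std_gauss I) + w"
    using integrable_loss by (simp add: prob_space)
  finally show ?thesis
    using integral_loss_le by (simp add: ennreal_leI)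
qed

end

lemma measurable_delta_A [measurable]:
  "j \<in> {1..p} \<Longrightarrow> (\<lambda>x. delta_A p d a x j) \<in> borel_measurable (PiM {1..p} (\<lambda>_. borel))"
  unfolding delta_A_def by measurable

lemma bayes_risk_delta_A_eq:
  fixes d \<gamma> a :: "nat \<Rightarrow> real"
  assumes \<gamma>: "\<And>j. j \<in> {1..p} \<Longrightarrow> \<gamma> j \<ge> 0" and d: "\<And>j. j \<in> {1..p} \<Longrightarrow> d j > 0"
  defines "v \<equiv> \<lambda>j. d j + \<gamma> j"
  defines "\<alpha> \<equiv> \<lambda>j. d j / sqrt (v j)" and "\<beta> \<equiv> \<lambda>j. sqrt (v j) * a j"
  shows "bayes_risk p d \<gamma> (delta_A p d a) = (\<integral>\<^sup>+ g. ennreal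
    (\<Sum>j\<in>{1..p}. (\<alpha> j * g j - cstar p d a / weighted_sum_sq {1..p} (\<lambda>j. (\<beta> j)\<^sup>2) g * (\<beta> j * g j))\<^sup>2
      + \<gamma> j * d j / v j)
    \<partial>std_gauss {1..p})"
proof -
  let ?I = "{1..p}" and ?S = "weighted_sum_sq {1..p} (\<lambda>j. (\<beta> j)\<^sup>2)"
  have v: "v j > 0" if "j \<in> ?I" for j
    using d[OF that] \<gamma>[OF that] by (simp add: v_def)
  define X where "X g = (\<lambda>j\<in>?I. 0 + sqrt (v j) * g j)" for g :: "nat \<Rightarrow> real"
  have residual: "delta_A p d a (X g) j - \<gamma> j / v j * X g j = \<alpha> j * g j - cstar p d a / ?S g * (\<beta> j * g j)"
    if j: "j \<in> ?I" for j g
  proof -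
    have "(\<Sum>k\<in>?I. (a k * X g k)\<^sup>2) = ?S g"
      unfolding weighted_sum_sq_def \<beta>_def X_def
      by (intro sum.cong refl) (simp add: power_mult_distrib)
    then have "delta_A p d a (X g) j = sqrt (v j) * g j - cstar p d a / ?S g * (\<beta> j * g j)"
      using j by (simp add: delta_A_def X_def \<beta>_def mult_ac)
    moreover have "\<alpha> j = sqrt (v j) - \<gamma> j / v j * sqrt (v j)"
      using v[OF j] by (simp add: \<alpha>_def v_def field_simps)
    then have "\<alpha> j * g j = sqrt (v j) * g j - \<gamma> j / v j * X g j"
      using j by (simp add: X_def left_diff_distrib)
    ultimately show ?thesis by simp
  qed
  have "bayes_risk p d \<gamma> (delta_A p d a) = (\<integral>\<^sup>+ x. ennreal
      (\<Sum>j\<in>?I. (delta_A p d a x j - \<gamma> j / v j * x j)\<^sup>2 + \<gamma> j * d j / v j) \<partial>gauss_diag p (\<lambda>_. 0) v)"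
    unfolding v_def by (rule bayes_risk_eq[OF \<gamma> d]) measurable
  also have "\<dots> = (\<integral>\<^sup>+ g. ennreal
      (\<Sum>j\<in>?I. (delta_A p d a (X g) j - \<gamma> j / v j * X g j)\<^sup>2 + \<gamma> j * d j / v j) \<partial>std_gauss ?I)"
    unfolding X_def
    by (rule nn_integral_gauss_diag) (use v in \<open>auto intro: less_imp_le simp del: One_nat_def\<close>)
  finally show ?thesis
    by (simp only: residual cong: sum.cong)
qed

lemma sq_div_sqrt_add_variance:
  fixes d \<gamma> :: real
  assumes "d > 0" "\<gamma> \<ge> 0"
  shows "(d / sqrt (d + \<gamma>))\<^sup>2 + \<gamma> * d / (d + \<gamma>) = d"
proof -
  have "(d / sqrt (d + \<gamma>))\<^sup>2 + \<gamma> * d / (d + \<gamma>) = d * (d + \<gamma>) / (d + \<gamma>)"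
    using assms by (simp add: power_divide power2_eq_square add_divide_distrib[symmetric] algebra_simps)
  then show ?thesis using assms by simp
qed

theorem bayes_risk_delta_A_le:
  assumes p: "p \<ge> 3" and \<gamma>: "\<And>j. j \<in> {1..p} \<Longrightarrow> \<gamma> j \<ge> 0" and d: "\<And>j. j \<in> {1..p} \<Longrightarrow> d j > 0"
    and a: "\<And>j. j \<in> {1..p} \<Longrightarrow> a j \<noteq> 0" and cstar_nonneg: "cstar p d a \<ge> 0"
  shows "bayes_risk p d \<gamma> (delta_A p d a) \<le> ennreal
    ((\<Sum>j\<in>{1..p}. d j) - (cstar p d a)\<^sup>2 * (real p / ((real p - 2) * (\<Sum>j\<in>{1..p}. (d j + \<gamma> j) * (a j)\<^sup>2))))"
proof -
  let ?I = "{1..p}" and ?v = "\<lambda>j. d j + \<gamma> j"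
  let ?\<alpha> = "\<lambda>j. d j / sqrt (?v j)" and ?\<beta> = "\<lambda>j. sqrt (?v j) * a j"
    and ?B = "Max ((\<lambda>j. d j * a j) ` ?I)" and ?V = "\<Sum>j\<in>?I. \<gamma> j * d j / ?v j"
  have v: "?v j > 0" if "j \<in> ?I" for j
    using d[OF that] \<gamma>[OF that] by simp
  have \<alpha>\<beta>: "?\<alpha> j * ?\<beta> j = d j * a j" if "j \<in> ?I" for j
    using v[OF that] by simp
  have cstar: "cstar p d a = (\<Sum>j\<in>?I. ?\<alpha> j * ?\<beta> j) - 2 * ?B"
    by (simp only: cstar_def \<alpha>\<beta> cong: sum.cong)
  interpret shrinkage ?I ?\<alpha> ?\<beta> ?B
  proof
    show "?\<alpha> j * ?\<beta> j \<le> ?B" if "j \<in> ?I" for j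
      unfolding \<alpha>\<beta>[OF that] using that by (intro Max_ge) auto
    show "?\<beta> j \<noteq> 0" if "j \<in> ?I" for j
      using a[OF that] v[OF that] by simp
  qed (use p cstar_nonneg in \<open>auto simp: cstar\<close>)
  have factor: "factor = cstar p d a"
    by (simp only: factor_def cstar)
  have "?V \<ge> 0"
    using \<gamma> d
    by (intro sum_nonneg divide_nonneg_nonneg mult_nonneg_nonneg)
      (auto intro: less_imp_le add_nonneg_nonneg)
  have "bayes_risk p d \<gamma> (delta_A p d a) = (\<integral>\<^sup>+ g. ennreal (loss g + ?V) \<partial>std_gauss ?I)"
    by (simp only: bayes_risk_delta_A_eq[OF \<gamma> d] loss_def factor sum.distrib)
  also have "\<dots> \<le> ennreal ((\<Sum>j\<in>?I. (?\<alpha> j)\<^sup>2) + ?V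
      - factor\<^sup>2 * (real (card ?I) / ((real (card ?I) - 2) * (\<Sum>j\<in>?I. (?\<beta> j)\<^sup>2))))"
    using \<open>?V \<ge> 0\<close> by (rule nn_integral_loss_plus_const_le)
  also have "(\<Sum>j\<in>?I. (?\<alpha> j)\<^sup>2) + ?V = (\<Sum>j\<in>?I. d j)"
    unfolding sum.distrib[symmetric] using \<gamma> d by (intro sum.cong refl sq_div_sqrt_add_variance) auto
  also have "(\<Sum>j\<in>?I. (?\<beta> j)\<^sup>2) = (\<Sum>j\<in>?I. ?v j * (a j)\<^sup>2)"
    using v by (intro sum.cong refl) (simp add: power_mult_distrib less_imp_le)
  finally show ?thesis
    unfolding factor by simp
qed

subsection \<open>The maximizer\<close>

definition excess :: "'i set \<Rightarrow> ('i \<Rightarrow> real) \<Rightarrow> real" where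
  "excess I x = (\<Sum>i\<in>I. x i) - 2 * Max (x ` I)"

lemma excess_cong: "(\<And>i. i \<in> I \<Longrightarrow> x i = y i) \<Longrightarrow> excess I x = excess I y"
  by (simp add: excess_def cong: sum.cong image_cong)

lemma excess_const: "I \<noteq> {} \<Longrightarrow> excess I (\<lambda>_. r) = (real (card I) - 2) * r"
  by (simp add: excess_def image_constant_conv left_diff_distrib)

lemma excess_scale:
  assumes "finite I" "I \<noteq> {}" "r \<ge> 0"
  shows "excess I (\<lambda>i. r * x i) = r * excess I x"
proof -
  have "r * Max (x ` I) = Max ((*) r ` x ` I)"
    by (rule mono_Max_commute) (use assms in \<open>auto intro: monoI mult_left_mono\<close>)
  then show ?thesis
    by (simp add: excess_def image_image right_diff_distrib sum_distrib_left)
qed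

lemma sum_fun_upd:
  fixes f :: "'a \<Rightarrow> 'b \<Rightarrow> 'c :: ab_group_add"
  assumes I: "finite I" "i \<in> I"
  shows "(\<Sum>k\<in>I. f k ((x(i := y)) k)) = (\<Sum>k\<in>I. f k (x k)) + (f i y - f i (x i))"
proof -
  have "(\<Sum>k\<in>I - {i}. f k ((x(i := y)) k)) = (\<Sum>k\<in>I - {i}. f k (x k))"
    by (intro sum.cong) auto
  then show ?thesis
    using sum.remove[OF I, of "\<lambda>k. f k ((x(i := y)) k)"] sum.remove[OF I, of "\<lambda>k. f k (x k)"]
    by simp
qed

locale excess_maximizer =
  fixes I :: "'i set" and D b :: "'i \<Rightarrow> real"
  assumes finite: "finite I" and card_ge: "card I \<ge> 3"
    and D_pos: "\<And>i. i \<in> I \<Longrightarrow> D i > 0" and b_nonneg: "\<And>i. i \<in> I \<Longrightarrow> b i \<ge> 0"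
    and energy_pos: "(\<Sum>i\<in>I. (b i)\<^sup>2 / D i) > 0"
    and excess_le: "\<And>x. (\<And>i. i \<in> I \<Longrightarrow> x i \<ge> 0) \<Longrightarrow>
      (\<Sum>i\<in>I. (x i)\<^sup>2 / D i) = (\<Sum>i\<in>I. (b i)\<^sup>2 / D i) \<Longrightarrow> excess I x \<le> excess I b"
begin

abbreviation "energy x \<equiv> \<Sum>i\<in>I. (x i)\<^sup>2 / D i"
abbreviation "peak \<equiv> Max (b ` I)"
abbreviation "max_ratio \<equiv> (excess I b)\<^sup>2 / energy b"

definition lam :: real where
  "lam = energy b / excess I b"

lemma nonempty: "I \<noteq> {}"
  using card_ge by auto

lemma le_peak: "i \<in> I \<Longrightarrow> b i \<le> peak"
  using finite by (intro Max_ge) auto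

lemma energy_nonneg: "energy x \<ge> 0"
  by (intro sum_nonneg divide_nonneg_nonneg less_imp_le[OF D_pos]) auto

lemma excess_le_sqrt_energy:
  assumes x: "\<And>i. i \<in> I \<Longrightarrow> x i \<ge> 0" and pos: "energy x > 0"
  shows "excess I x \<le> excess I b * sqrt (energy x / energy b)"
proof -
  define r where "r = sqrt (energy x / energy b)"
  have r: "r > 0" "r\<^sup>2 = energy x / energy b"
    using pos energy_pos by (auto simp: r_def)
  have "energy (\<lambda>i. 1 / r * x i) = energy x / r\<^sup>2"
    by (simp add: power_divide sum_divide_distrib divide_divide_eq_left mult.commute)
  also have "\<dots> = energy b"
    using pos unfolding r(2) by simp
  finally have "excess I (\<lambda>i. 1 / r * x i) \<le> excess I b"
    using x r(1) by (intro excess_le) auto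
  then have "1 / r * excess I x \<le> excess I b"
    using excess_scale[OF finite nonempty, of "1 / r" x] r(1) by simp
  then show ?thesis
    using r(1) unfolding r_def[symmetric] by (simp add: field_simps)
qed

lemma excess_pos: "excess I b > 0"
proof -
  have "0 < excess I (\<lambda>_. 1)"
    using card_ge nonempty by (simp add: excess_const)
  also have pos: "energy (\<lambda>_. 1) > 0"
    using finite nonempty D_pos by (intro sum_pos) auto
  then have "excess I (\<lambda>_. 1) \<le> excess I b * sqrt (energy (\<lambda>_. 1) / energy b)"
    by (intro excess_le_sqrt_energy) auto
  finally show ?thesis
    using pos energy_pos by (intro zero_less_mult_pos2[of "excess I b" "sqrt (energy (\<lambda>_. 1) / energy b)"]) auto
qed

lemma lam_pos: "lam > 0"
  using excess_pos energy_pos by (simp add: lam_def)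

lemma
  shows energy_eq_lam_mult_excess: "energy b = lam * excess I b"
    and max_ratio_eq_excess_div_lam: "max_ratio = excess I b / lam"
  using excess_pos energy_pos by (simp_all add: lam_def power2_eq_square)

text \<open>By homogeneity and AM-GM the constrained maximizer also maximizes the unconstrained
  concave functional \<open>excess I x - energy x / (2 * lam)\<close>.\<close>

lemma excess_le_penalized:
  assumes x: "\<And>i. i \<in> I \<Longrightarrow> x i \<ge> 0"
  shows "excess I x \<le> excess I b / 2 + energy x / (2 * lam)"
proof (cases "energy x = 0")
  case True
  then have "\<forall>i\<in>I. (x i)\<^sup>2 / D i = 0"
    by (subst (asm) sum_nonneg_eq_0_iff[OF finite]) (auto intro!: divide_nonneg_nonneg less_imp_le[OF D_pos])
  then have "x i = 0" if "i \<in> I" for i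
    using D_pos[OF that] that by fastforce
  then have "excess I x = excess I (\<lambda>_. 0)"
    by (rule excess_cong)
  with True show ?thesis
    using excess_pos nonempty by (simp add: excess_const)
next
  case False
  define q where "q = sqrt (energy x / energy b)"
  have q: "q\<^sup>2 = energy x / energy b"
    using energy_nonneg energy_pos by (simp add: q_def)
  have "excess I x \<le> excess I b * q"
    unfolding q_def using x energy_nonneg[of x] False by (intro excess_le_sqrt_energy) auto
  also have "\<dots> \<le> excess I b * ((1 + q\<^sup>2) / 2)"
    using sum_squares_bound[of 1 q] excess_pos by (intro mult_left_mono) auto
  also have "\<dots> = excess I b / 2 + energy x / (2 * lam)"
    using excess_pos energy_pos by (simp add: q lam_def field_simps)
  finally show ?thesis .
qed

lemma peak_pos: "peak > 0"
proof (rule ccontr)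
  assume "\<not> peak > 0"
  then have "b i = 0" if "i \<in> I" for i
    using le_peak[OF that] b_nonneg[OF that] by linarith
  then have "excess I b = excess I (\<lambda>_. 0)"
    by (rule excess_cong)
  then show False
    using excess_pos nonempty by (simp add: excess_const)
qed

lemma excess_fun_upd_ge:
  assumes i: "i \<in> I" and y: "y \<le> peak"
  shows "excess I b + (y - b i) \<le> excess I (b(i := y))"
proof -
  have "Max ((b(i := y)) ` I) \<le> peak"
    using finite nonempty y le_peak by (subst Max_le_iff) auto
  then show ?thesis
    using sum_fun_upd[OF finite i, of "\<lambda>_ z. z" b y] by (simp add: excess_def)
qed

lemma sq_dist_lam_D_le:
  assumes i: "i \<in> I" and y: "0 \<le> y" "y \<le> peak"
  shows "(b i - lam * D i)\<^sup>2 \<le> (y - lam * D i)\<^sup>2"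
proof -
  let ?L = "lam * D i"
  have L: "?L > 0" using lam_pos D_pos[OF i] by simp
  have "excess I b + (y - b i) \<le> excess I (b(i := y))"
    using i y(2) by (rule excess_fun_upd_ge)
  also have "\<dots> \<le> excess I b / 2 + energy (b(i := y)) / (2 * lam)"
    using y(1) b_nonneg by (intro excess_le_penalized) auto
  also have "energy (b(i := y)) = energy b + (y\<^sup>2 - (b i)\<^sup>2) / D i"
    using sum_fun_upd[OF finite i, of "\<lambda>k z. z\<^sup>2 / D k" b y] by (simp add: diff_divide_distrib)
  also have "excess I b / 2 + (energy b + (y\<^sup>2 - (b i)\<^sup>2) / D i) / (2 * lam) =
      excess I b + (y\<^sup>2 - (b i)\<^sup>2) / (2 * ?L)"
  proof -
    have "energy b / (2 * lam) = excess I b / 2"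
      using energy_pos excess_pos by (simp add: lam_def)
    then show ?thesis
      by (simp add: add_divide_distrib mult_ac)
  qed
  finally have "y - b i \<le> (y\<^sup>2 - (b i)\<^sup>2) / (2 * ?L)"
    by simp
  then have "(y - b i) * (2 * ?L) \<le> y\<^sup>2 - (b i)\<^sup>2"
    using L by (simp only: pos_le_divide_eq zero_less_mult_iff zero_less_numeral simp_thms)
  then show ?thesis
    by (simp add: power2_eq_square algebra_simps)
qed

lemma maximizer_eq_min:
  assumes i: "i \<in> I"
  shows "b i = min peak (lam * D i)"
proof (cases "lam * D i \<le> peak")
  case True
  then have "(b i - lam * D i)\<^sup>2 \<le> 0"
    using sq_dist_lam_D_le[OF i, of "lam * D i"] lam_pos D_pos[OF i] by simp
  with True show ?thesis by simp
next
  case False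
  then have "(lam * D i - b i)\<^sup>2 \<le> (lam * D i - peak)\<^sup>2"
    using sq_dist_lam_D_le[OF i, of peak] peak_pos by (simp add: power2_commute)
  then have "lam * D i - b i \<le> lam * D i - peak"
    by (rule power2_le_imp_le) (use False in simp)
  with False le_peak[OF i] show ?thesis by simp
qed

lemma maximizer_pos: "i \<in> I \<Longrightarrow> b i > 0"
  using maximizer_eq_min[of i] peak_pos lam_pos D_pos[of i] by simp

end

subsection \<open>The value of the maximum\<close>

lemma sq_div_Suc_ge:
  fixes k u :: real
  assumes k: "k > 2" and u: "k - 2 \<le> u" "u \<le> k"
  shows "(k - 2)\<^sup>2 / u + 1 - 4 / (k * (k + 1)) \<le> (k - 1)\<^sup>2 / (u + 1)"
proof -
  define t where "t = u - (k - 2)"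
  have t: "0 \<le> t" "t \<le> 2" and u_pos: "u > 0"
    using k u by (auto simp: t_def)
  have "(t - 2) * (k / 2 - 1) \<le> 0" "(t - 2) * (k - 1) \<le> 0"
    using t k by (auto intro: mult_nonpos_nonneg)
  then have "t * k / 2 \<le> u" "t * (k + 1) / 2 \<le> u + 1"
    by (auto simp: t_def field_simps)
  then have "(t * k / 2) * (t * (k + 1) / 2) \<le> u * (u + 1)"
    using t k u_pos by (intro mult_mono) auto
  then have "t\<^sup>2 * (k * (k + 1)) \<le> 4 * (u * (u + 1))"
    by (simp add: power2_eq_square algebra_simps)
  then have "t\<^sup>2 / (u * (u + 1)) \<le> 4 / (k * (k + 1))"
    using u_pos k by (simp add: divide_le_eq pos_le_divide_eq)
  moreover have "(k - 2)\<^sup>2 / u + 1 - (k - 1)\<^sup>2 / (u + 1) = t\<^sup>2 / (u * (u + 1))"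
  proof -
    have "(k - 2)\<^sup>2 / u + 1 - (k - 1)\<^sup>2 / (u + 1) =
        ((k - 2)\<^sup>2 * (u + 1) + u * (u + 1) - (k - 1)\<^sup>2 * u) / (u * (u + 1))"
      using u_pos by (simp add: add_divide_distrib diff_divide_distrib)
    also have "(k - 2)\<^sup>2 * (u + 1) + u * (u + 1) - (k - 1)\<^sup>2 * u = t\<^sup>2"
      by (simp add: t_def power2_eq_square algebra_simps)
    finally show ?thesis .
  qed
  ultimately show ?thesis by linarith
qed

context
  fixes D :: "nat \<Rightarrow> real" and n :: nat
  assumes D_pos: "\<And>j. 1 \<le> j \<Longrightarrow> j \<le> n \<Longrightarrow> D j > 0"
    and D_antimono: "\<And>i j. 1 \<le> i \<Longrightarrow> i \<le> j \<Longrightarrow> j \<le> n \<Longrightarrow> D j \<le> D i"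
begin

lemma mult_sum_inverse_le: "D k * (\<Sum>j\<in>{1..m}. 1 / D j) \<le> m" if "1 \<le> k" "m \<le> k" "k \<le> n"
proof -
  have "(\<Sum>j\<in>{1..m}. 1 / D j) \<le> (\<Sum>j\<in>{1..m}. 1 / D k)"
    using that by (intro sum_mono frac_le D_pos D_antimono) auto
  then show ?thesis
    using D_pos[OF that(1,3)] by (simp add: field_simps)
qed

lemma sum_inverse_pos: "(\<Sum>j\<in>{1..m}. 1 / D j) > 0" if "1 \<le> m" "m \<le> n"
  using that by (intro sum_pos divide_pos_pos D_pos) auto

lemma minus_two_le_mult_sum_inverse:
  assumes last: "real n - 2 \<le> D n * (\<Sum>j\<in>{1..n}. 1 / D j)" and k: "1 \<le> k" "k \<le> n"
  shows "real k - 2 \<le> D k * (\<Sum>j\<in>{1..k}. 1 / D j)"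
  using k(2,1)
proof (induction k rule: inc_induct)
  case base
  show ?case by (rule last)
next
  case (step k)
  have "D (Suc k) * (\<Sum>j\<in>{1..Suc k}. 1 / D j) = D (Suc k) * (\<Sum>j\<in>{1..k}. 1 / D j) + 1"
    using D_pos[of "Suc k"] step.hyps by (simp add: distrib_left)
  also have "\<dots> \<le> D k * (\<Sum>j\<in>{1..k}. 1 / D j) + 1"
    using step.hyps step.prems sum_inverse_pos[of k]
    by (intro add_right_mono mult_right_mono D_antimono) auto
  finally show ?case
    using step.IH by simp
qed

text \<open>Passing from \<open>k\<close> to \<open>k + 1\<close> loses at most \<open>4 * D (k + 1) / (k * (k + 1))\<close>, the
  defect in the Cauchy-Schwarz inequality, and these losses telescope.\<close>

lemma sum_le_sq_div_sum_inverse: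
  assumes last: "real n - 2 \<le> D n * (\<Sum>j\<in>{1..n}. 1 / D j)" and k: "4 \<le> k" "k \<le> n"
  shows "4 * D k / real k + (\<Sum>j\<in>{5..k}. D j) \<le> (real k - 2)\<^sup>2 / (\<Sum>j\<in>{1..k}. 1 / D j)"
  using k
proof (induction k rule: nat_induct_at_least)
  case base
  then show ?case
    using mult_sum_inverse_le[of 4 4] sum_inverse_pos[of 4] by (simp add: pos_le_divide_eq)
next
  case (Suc k)
  define W where "W = (\<Sum>j\<in>{1..k}. 1 / D j)"
  define E where "E = D (Suc k)"
  define u where "u = E * W"
  have E: "E > 0" "E \<le> D k"
    unfolding E_def using Suc by (auto intro: D_pos D_antimono)
  have sum_Suc: "(\<Sum>j\<in>{1..Suc k}. 1 / D j) = W + 1 / E"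
    by (simp add: W_def E_def)
  have u: "real k - 2 \<le> u" "u \<le> k"
  proof -
    have "real (Suc k) - 2 \<le> E * (W + 1 / E)"
      using minus_two_le_mult_sum_inverse[OF last, of "Suc k", unfolded sum_Suc, folded E_def] Suc by simp
    then show "real k - 2 \<le> u"
      using E by (simp add: u_def distrib_left)
    show "u \<le> k"
      using mult_sum_inverse_le[of "Suc k" k] Suc by (simp add: u_def W_def E_def)
  qed
  have telescope: "4 * E / real k - 4 * E / (real k * (real k + 1)) = 4 * E / real (Suc k)"
    using \<open>4 \<le> k\<close> by (simp add: divide_simps) (auto simp: algebra_simps add_nonneg_eq_0_iff)
  have "4 * D (Suc k) / real (Suc k) + (\<Sum>j\<in>{5..Suc k}. D j) =
      4 * E / real k + (\<Sum>j\<in>{5..k}. D j) + E - 4 * E / (real k * (real k + 1))"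
    using Suc telescope by (simp add: E_def)
  also have "\<dots> \<le> 4 * D k / real k + (\<Sum>j\<in>{5..k}. D j) + E - 4 * E / (real k * (real k + 1))"
    using E by (simp add: divide_right_mono)
  also have "\<dots> \<le> (real k - 2)\<^sup>2 / W + E - 4 * E / (real k * (real k + 1))"
    using Suc by (simp add: W_def)
  also have "\<dots> = E * ((real k - 2)\<^sup>2 / u + 1 - 4 / (real k * (real k + 1)))"
    using E by (simp add: u_def algebra_simps)
  also have "\<dots> \<le> E * ((real k - 1)\<^sup>2 / (u + 1))"
    using Suc u E by (intro mult_left_mono sq_div_Suc_ge) auto
  also have "\<dots> = (real (Suc k) - 2)\<^sup>2 / (W + 1 / E)"
    using E by (simp add: u_def field_simps)
  finally show ?case
    by (simp only: sum_Suc)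
qed

end

locale sorted_excess_maximizer = excess_maximizer "{1..p}" D b for p :: nat and D b :: "nat \<Rightarrow> real" +
  assumes sorted: "\<And>i j. 1 \<le> i \<Longrightarrow> i \<le> j \<Longrightarrow> j \<le> p \<Longrightarrow> D j \<le> D i"
begin

definition \<nu> :: nat where
  "\<nu> = (GREATEST k. k \<in> {1..p} \<and> b k = peak)"

abbreviation "inverse_sum \<equiv> \<Sum>j\<in>{1..\<nu>}. 1 / D j"

lemma
  shows \<nu>_mem: "\<nu> \<in> {1..p}" and b_at_\<nu>: "b \<nu> = peak"
    and less_peak_above_\<nu>: "\<And>j. j \<in> {1..p} \<Longrightarrow> \<nu> < j \<Longrightarrow> b j < peak"
proof -
  let ?Q = "\<lambda>k. k \<in> {1..p} \<and> b k = peak"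
  have "peak \<in> b ` {1..p}"
    using finite nonempty by (intro Max_in) auto
  then obtain k where "?Q k" by auto
  then have "?Q \<nu>"
    unfolding \<nu>_def by (rule GreatestI_nat) auto
  then show "\<nu> \<in> {1..p}" "b \<nu> = peak" by auto
  fix j assume j: "j \<in> {1..p}" "\<nu> < j"
  have "b j \<noteq> peak"
  proof
    assume "b j = peak"
    then have "j \<le> \<nu>"
      unfolding \<nu>_def using j(1) by (intro Greatest_le_nat[of ?Q _ p]) auto
    with j show False by simp
  qed
  with le_peak[OF j(1)] show "b j < peak" by simp
qed

lemma split_at_\<nu>:
  "m \<le> \<nu> + 1 \<Longrightarrow> (\<Sum>j\<in>{m..p}. f j) = (\<Sum>j\<in>{m..\<nu>}. f j) + (\<Sum>j\<in>{\<nu>+1..p}. f j)"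
  using sum.ub_add_nat[of m \<nu> f "p - \<nu>"] \<nu>_mem by simp

lemma peak_le_lam_D: "peak \<le> lam * D \<nu>"
  using maximizer_eq_min[OF \<nu>_mem] b_at_\<nu> by linarith

lemma eq_peak_upto_\<nu>: "b j = peak" if j: "j \<in> {1..\<nu>}"
proof -
  have "lam * D \<nu> \<le> lam * D j"
    using sorted[of j \<nu>] j \<nu>_mem lam_pos by (intro mult_left_mono) auto
  moreover have "j \<in> {1..p}"
    using j \<nu>_mem by auto
  ultimately show ?thesis
    using peak_le_lam_D maximizer_eq_min[of j] by linarith
qed

lemma eq_lam_D_above_\<nu>: "b j = lam * D j" if "j \<in> {\<nu>+1..p}"
  using less_peak_above_\<nu>[of j] maximizer_eq_min[of j] that by (auto simp: min_def split: if_splits)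

lemma inverse_sum_pos: "inverse_sum > 0"
  using \<nu>_mem by (intro sum_pos divide_pos_pos D_pos) auto

lemma
  shows excess_eq: "excess {1..p} b = (real \<nu> - 2) * peak + lam * (\<Sum>j\<in>{\<nu>+1..p}. D j)"
    and energy_eq: "energy b = peak\<^sup>2 * inverse_sum + lam\<^sup>2 * (\<Sum>j\<in>{\<nu>+1..p}. D j)"
proof -
  have "(\<Sum>j\<in>{1..p}. b j) = (\<Sum>j\<in>{1..\<nu>}. peak) + (\<Sum>j\<in>{\<nu>+1..p}. lam * D j)"
    unfolding split_at_\<nu>[OF le_add2]
    by (intro arg_cong2[where f="(+)"] sum.cong refl eq_peak_upto_\<nu> eq_lam_D_above_\<nu>)
  then show "excess {1..p} b = (real \<nu> - 2) * peak + lam * (\<Sum>j\<in>{\<nu>+1..p}. D j)"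
    by (simp add: excess_def left_diff_distrib sum_distrib_left)
  have "energy b = (\<Sum>j\<in>{1..\<nu>}. peak\<^sup>2 * (1 / D j)) + (\<Sum>j\<in>{\<nu>+1..p}. lam\<^sup>2 * D j)"
    unfolding split_at_\<nu>[OF le_add2]
  proof (intro arg_cong2[where f="(+)"] sum.cong refl)
    show "(b j)\<^sup>2 / D j = peak\<^sup>2 * (1 / D j)" if "j \<in> {1..\<nu>}" for j
      by (simp add: eq_peak_upto_\<nu>[OF that])
    show "(b j)\<^sup>2 / D j = lam\<^sup>2 * D j" if "j \<in> {\<nu>+1..p}" for j
      using D_pos[of j] that by (simp add: eq_lam_D_above_\<nu>[OF that] power2_eq_square)
  qed
  then show "energy b = peak\<^sup>2 * inverse_sum + lam\<^sup>2 * (\<Sum>j\<in>{\<nu>+1..p}. D j)"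
    by (simp only: sum_distrib_left)
qed

lemma peak_eq: "peak = lam * ((real \<nu> - 2) / inverse_sum)"
proof -
  have "peak * (peak * inverse_sum) = peak * (lam * (real \<nu> - 2))"
    using energy_eq_lam_mult_excess unfolding energy_eq excess_eq by (simp add: power2_eq_square algebra_simps)
  then have "peak * inverse_sum = lam * (real \<nu> - 2)"
    using peak_pos by simp
  then show ?thesis
    using inverse_sum_pos by (simp add: field_simps)
qed

lemma max_ratio_eq: "max_ratio = (real \<nu> - 2)\<^sup>2 / inverse_sum + (\<Sum>j\<in>{\<nu>+1..p}. D j)"
proof -
  have "excess {1..p} b / lam = (real \<nu> - 2)\<^sup>2 / inverse_sum + (\<Sum>j\<in>{\<nu>+1..p}. D j)"
    unfolding excess_eq peak_eq using lam_pos by (simp add: add_divide_distrib power2_eq_square)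
  then show ?thesis
    by (simp only: max_ratio_eq_excess_div_lam)
qed

lemma \<nu>_le_D_mult_inverse_sum: "real \<nu> - 2 \<le> D \<nu> * inverse_sum"
proof -
  have "(real \<nu> - 2) / inverse_sum \<le> D \<nu>"
    using peak_le_lam_D[unfolded peak_eq] lam_pos by (rule mult_left_le_imp_le)
  then show ?thesis
    using inverse_sum_pos by (simp add: field_simps)
qed

lemma max_ratio_ge_if_\<nu>_eq_3:
  assumes "\<nu> = 3"
  shows "D 3 / 3 + (\<Sum>j\<in>{4..p}. D j) \<le> max_ratio"
proof -
  have "D 3 * inverse_sum \<le> 3"
    using mult_sum_inverse_le[of 3 D 3 3] \<nu>_mem assms D_pos sorted by simp
  then have "D 3 / 3 \<le> 1 / inverse_sum"
    using inverse_sum_pos by (simp add: field_simps)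
  then show ?thesis
    unfolding max_ratio_eq by (simp add: assms)
qed

lemma max_ratio_ge_if_\<nu>_ge_4:
  assumes "\<nu> \<ge> 4"
  shows "4 * D \<nu> / real \<nu> + (\<Sum>j\<in>{5..p}. D j) \<le> max_ratio"
proof -
  have "(\<Sum>j\<in>{5..p}. D j) = (\<Sum>j\<in>{5..\<nu>}. D j) + (\<Sum>j\<in>{\<nu>+1..p}. D j)"
    using assms by (intro split_at_\<nu>) simp
  moreover have "4 * D \<nu> / real \<nu> + (\<Sum>j\<in>{5..\<nu>}. D j) \<le> (real \<nu> - 2)\<^sup>2 / inverse_sum"
    by (rule sum_le_sq_div_sum_inverse[OF _ _ \<nu>_le_D_mult_inverse_sum]) (use assms \<nu>_mem D_pos sorted in auto)
  ultimately show ?thesis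
    unfolding max_ratio_eq by linarith
qed

end

subsection \<open>The risk bounds\<close>

lemma dstar_pos: "d j > 0 \<Longrightarrow> \<gamma> j \<ge> 0 \<Longrightarrow> dstar d \<gamma> j > 0"
  by (simp add: dstar_def)

lemma weight_eq_sq_div_dstar:
  assumes "d j > 0" "\<gamma> j \<ge> 0"
  shows "(d j + \<gamma> j) * x\<^sup>2 = (d j * x)\<^sup>2 / dstar d \<gamma> j"
  using assms by (simp add: dstar_def power_mult_distrib)

lemma cstar_eq_excess: "cstar p d a = excess {1..p} (\<lambda>j. d j * a j)"
  by (simp add: cstar_def excess_def)

lemma feasible_iff:
  assumes d: "\<And>j. j \<in> {1..p} \<Longrightarrow> d j > 0" and \<gamma>: "\<And>j. j \<in> {1..p} \<Longrightarrow> \<gamma> j \<ge> 0"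
  shows "feasible p d \<gamma> a \<longleftrightarrow> (\<forall>j\<in>{1..p}. a j \<ge> 0) \<and>
    (\<Sum>j\<in>{1..p}. (d j * a j)\<^sup>2 / dstar d \<gamma> j) = (\<Sum>j\<in>{1..p}. dstar d \<gamma> j)"
proof -
  have "(\<Sum>j\<in>{1..p}. (d j + \<gamma> j) * (a j)\<^sup>2) = (\<Sum>j\<in>{1..p}. (d j * a j)\<^sup>2 / dstar d \<gamma> j)"
    by (intro sum.cong refl weight_eq_sq_div_dstar d \<gamma>)
  then show ?thesis by (simp add: feasible_def)
qed

locale cstar_maximizer =
  fixes p :: nat and d \<gamma> a :: "nat \<Rightarrow> real"
  assumes p_ge: "p \<ge> 3"
    and d_pos: "\<And>j. j \<in> {1..p} \<Longrightarrow> d j > 0"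
    and \<gamma>_nonneg: "\<And>j. j \<in> {1..p} \<Longrightarrow> \<gamma> j \<ge> 0"
    and dstar_sorted: "\<And>i j. 1 \<le> i \<Longrightarrow> i \<le> j \<Longrightarrow> j \<le> p \<Longrightarrow> dstar d \<gamma> j \<le> dstar d \<gamma> i"
    and a_feasible: "feasible p d \<gamma> a"
    and cstar_le: "\<And>b. feasible p d \<gamma> b \<Longrightarrow> cstar p d b \<le> cstar p d a"
begin

sublocale sorted_excess_maximizer p "dstar d \<gamma>" "\<lambda>j. d j * a j"
proof
  show "card {1..p} \<ge> 3" using p_ge by simp
  show D_pos: "dstar d \<gamma> j > 0" if "j \<in> {1..p}" for j
    using that d_pos \<gamma>_nonneg by (intro dstar_pos) auto
  show "d j * a j \<ge> 0" if "j \<in> {1..p}" for j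
    using that d_pos[OF that] a_feasible by (auto simp: feasible_def)
  have energy: "(\<Sum>j\<in>{1..p}. (d j * a j)\<^sup>2 / dstar d \<gamma> j) = (\<Sum>j\<in>{1..p}. dstar d \<gamma> j)"
    using a_feasible feasible_iff[OF d_pos \<gamma>_nonneg] by simp
  show "(\<Sum>j\<in>{1..p}. (d j * a j)\<^sup>2 / dstar d \<gamma> j) > 0"
    unfolding energy using p_ge D_pos by (intro sum_pos) auto
  fix x :: "nat \<Rightarrow> real"
  assume x: "\<And>j. j \<in> {1..p} \<Longrightarrow> x j \<ge> 0"
    and eq: "(\<Sum>j\<in>{1..p}. (x j)\<^sup>2 / dstar d \<gamma> j) = (\<Sum>j\<in>{1..p}. (d j * a j)\<^sup>2 / dstar d \<gamma> j)"
  have rescale: "d j * (x j / d j) = x j" if "j \<in> {1..p}" for j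
    using d_pos[OF that] by simp
  have "(\<Sum>j\<in>{1..p}. (d j * (x j / d j))\<^sup>2 / dstar d \<gamma> j) = (\<Sum>j\<in>{1..p}. (x j)\<^sup>2 / dstar d \<gamma> j)"
    by (intro sum.cong refl) (simp only: rescale)
  also note eq
  also note energy
  finally have scaled: "(\<Sum>j\<in>{1..p}. (d j * (x j / d j))\<^sup>2 / dstar d \<gamma> j) = (\<Sum>j\<in>{1..p}. dstar d \<gamma> j)" .
  have "feasible p d \<gamma> (\<lambda>j. x j / d j)"
    by (intro feasible_iff[THEN iffD2] conjI ballI divide_nonneg_pos x d_pos \<gamma>_nonneg scaled)
  from cstar_le[OF this] show "excess {1..p} x \<le> excess {1..p} (\<lambda>j. d j * a j)"
    unfolding cstar_eq_excess using excess_cong[of "{1..p}" "\<lambda>j. d j * (x j / d j)" x] rescale by simp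
qed (use dstar_sorted in auto)

lemma nu_idx_eq: "nu_idx p d a = \<nu>"
  by (simp add: nu_idx_def \<nu>_def)

abbreviation "risk \<equiv> bayes_risk p d \<gamma> (delta_A p d a)"
abbreviation "tr_D \<equiv> \<Sum>j\<in>{1..p}. d j"
abbreviation "tail m \<equiv> \<Sum>j\<in>{m..p}. dstar d \<gamma> j"

lemma bayes_risk_le_of_max_ratio_ge:
  assumes "q + tail m \<le> max_ratio"
  shows "risk \<le> ennreal (tr_D - tail m - 2 / (real p - 2) * tail m - real p / (real p - 2) * q)"
proof -
  define r where "r = real p / (real p - 2)"
  have r: "r \<ge> 0" "r = 1 + 2 / (real p - 2)"
    using p_ge by (auto simp: r_def field_simps)
  have energy: "(\<Sum>j\<in>{1..p}. (d j + \<gamma> j) * (a j)\<^sup>2) = energy (\<lambda>j. d j * a j)"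
    by (intro sum.cong refl weight_eq_sq_div_dstar d_pos \<gamma>_nonneg)
  have a: "a j \<noteq> 0" if "j \<in> {1..p}" for j
    using maximizer_pos[OF that] by auto
  have "cstar p d a \<ge> 0"
    using excess_pos by (simp only: cstar_eq_excess less_imp_le)
  from bayes_risk_delta_A_le[of p \<gamma> d a, OF p_ge \<gamma>_nonneg d_pos a this]
  have "risk \<le> ennreal (tr_D - (cstar p d a)\<^sup>2 * (real p / ((real p - 2) * energy (\<lambda>j. d j * a j))))"
    unfolding energy .
  also have "(cstar p d a)\<^sup>2 * (real p / ((real p - 2) * energy (\<lambda>j. d j * a j))) = r * max_ratio"
    unfolding r_def cstar_eq_excess by (simp add: mult.commute)
  also have "ennreal (tr_D - r * max_ratio) \<le> ennreal (tr_D - r * (q + tail m))"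
    using assms r(1) by (intro ennreal_leI diff_left_mono mult_left_mono)
  also have "r * (q + tail m) = tail m + 2 / (real p - 2) * tail m + r * q"
    unfolding r(2) by (simp add: algebra_simps add_divide_distrib)
  finally show ?thesis
    by (simp add: r_def algebra_simps)
qed

lemma tail_nonneg: "m \<ge> 1 \<Longrightarrow> tail m \<ge> 0"
  by (intro sum_nonneg less_imp_le[OF D_pos]) auto

lemma tail_eq: "m \<le> p \<Longrightarrow> tail m = dstar d \<gamma> m + tail (Suc m)"
  by (rule sum.atLeast_Suc_atMost)

lemma tail_3_eq: "tail 3 = dstar d \<gamma> 3 + tail 4"
  using tail_eq[of 3] p_ge by simp

lemma ratio_ge: "2 / (real p - 2) \<ge> 0" "real p / (real p - 2) \<ge> 1"
  using p_ge by (simp_all add: le_divide_eq)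

lemma
  assumes "\<nu> = 3"
  defines "bound \<equiv> tr_D - tail 3 + (dstar d \<gamma> 3 - 2 / (real p - 2) * tail 4
    - real p / (real p - 2) * (dstar d \<gamma> 3 / 3))"
  shows bayes_risk_le_if_\<nu>_eq_3: "risk \<le> ennreal bound"
    and bound_le_if_\<nu>_eq_3: "bound \<le> tr_D - tail 3 + 2 / 3 * dstar d \<gamma> 3"
proof -
  show "risk \<le> ennreal bound"
    using bayes_risk_le_of_max_ratio_ge[OF max_ratio_ge_if_\<nu>_eq_3[OF assms(1)]]
    by (simp add: bound_def tail_3_eq algebra_simps)
  have "2 / (real p - 2) * tail 4 \<ge> 0"
    using ratio_ge(1) tail_nonneg[of 4] by (intro mult_nonneg_nonneg) auto
  moreover have "real p / (real p - 2) * (dstar d \<gamma> 3 / 3) \<ge> 1 * (dstar d \<gamma> 3 / 3)"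
    using ratio_ge(2) D_pos[of 3] p_ge by (intro mult_right_mono) auto
  ultimately show "bound \<le> tr_D - tail 3 + 2 / 3 * dstar d \<gamma> 3"
    unfolding bound_def by linarith
qed

lemma
  assumes "\<nu> \<ge> 4"
  defines "bound \<equiv> tr_D - tail 3 + (dstar d \<gamma> 3 + dstar d \<gamma> 4 - 2 / (real p - 2) * tail 5
    - 4 * real p / (real p - 2) * (dstar d \<gamma> \<nu> / real \<nu>))"
  shows bayes_risk_le_if_\<nu>_ge_4: "risk \<le> ennreal bound"
    and bound_le_if_\<nu>_ge_4: "bound \<le> tr_D - tail 3 + (dstar d \<gamma> 3 + dstar d \<gamma> 4)"
proof -
  have "tail 4 = dstar d \<gamma> 4 + tail 5"
    using tail_eq[of 4] assms(1) \<nu>_mem by simp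
  then show "risk \<le> ennreal bound"
    using bayes_risk_le_of_max_ratio_ge[OF max_ratio_ge_if_\<nu>_ge_4[OF assms(1)]]
    by (simp add: bound_def tail_3_eq algebra_simps)
  have "2 / (real p - 2) * tail 5 \<ge> 0"
    using ratio_ge(1) tail_nonneg[of 5] by (intro mult_nonneg_nonneg) auto
  moreover have "4 * real p / (real p - 2) * (dstar d \<gamma> \<nu> / real \<nu>) \<ge> 0"
    using p_ge D_pos[OF \<nu>_mem] by (intro mult_nonneg_nonneg divide_nonneg_nonneg) auto
  ultimately show "bound \<le> tr_D - tail 3 + (dstar d \<gamma> 3 + dstar d \<gamma> 4)"
    unfolding bound_def by linarith
qed

end

theorem theorem3:
  fixes p :: nat and d \<gamma> a :: "nat \<Rightarrow> real"
  assumes p3: "p \<ge> 3"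
    and dpos: "\<forall>j\<in>{1..p}. d j > 0"
    and gnn: "\<forall>j\<in>{1..p}. \<gamma> j \<ge> 0"
    and sorted: "\<forall>i j. 1 \<le> i \<longrightarrow> i \<le> j \<longrightarrow> j \<le> p \<longrightarrow> dstar d \<gamma> j \<le> dstar d \<gamma> i"
    and a_feas: "feasible p d \<gamma> a"
    and a_max: "\<forall>b. feasible p d \<gamma> b \<longrightarrow> cstar p d b \<le> cstar p d a"
    and a_uniq: "\<forall>b. feasible p d \<gamma> b \<longrightarrow> cstar p d b = cstar p d a \<longrightarrow> (\<forall>j\<in>{1..p}. b j = a j)"
  shows "(nu_idx p d a = 3 \<longrightarrow>
            bayes_risk p d \<gamma> (delta_A p d a) \<le>
              ennreal ((\<Sum>j\<in>{1..p}. d j) - (\<Sum>j\<in>{3..p}. dstar d \<gamma> j)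
                + (dstar d \<gamma> 3 - 2 / (real p - 2) * (\<Sum>j\<in>{4..p}. dstar d \<gamma> j)
                   - real p / (real p - 2) * (dstar d \<gamma> 3 / 3)))
          \<and> (\<Sum>j\<in>{1..p}. d j) - (\<Sum>j\<in>{3..p}. dstar d \<gamma> j)
                + (dstar d \<gamma> 3 - 2 / (real p - 2) * (\<Sum>j\<in>{4..p}. dstar d \<gamma> j)
                   - real p / (real p - 2) * (dstar d \<gamma> 3 / 3))
            \<le> (\<Sum>j\<in>{1..p}. d j) - (\<Sum>j\<in>{3..p}. dstar d \<gamma> j) + 2 / 3 * dstar d \<gamma> 3)
       \<and> (nu_idx p d a \<ge> 4 \<longrightarrow>
            bayes_risk p d \<gamma> (delta_A p d a) \<le>
              ennreal ((\<Sum>j\<in>{1..p}. d j) - (\<Sum>j\<in>{3..p}. dstar d \<gamma> j)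
                + (dstar d \<gamma> 3 + dstar d \<gamma> 4 - 2 / (real p - 2) * (\<Sum>j\<in>{5..p}. dstar d \<gamma> j)
                   - 4 * real p / (real p - 2) * (dstar d \<gamma> (nu_idx p d a) / real (nu_idx p d a))))
          \<and> (\<Sum>j\<in>{1..p}. d j) - (\<Sum>j\<in>{3..p}. dstar d \<gamma> j)
                + (dstar d \<gamma> 3 + dstar d \<gamma> 4 - 2 / (real p - 2) * (\<Sum>j\<in>{5..p}. dstar d \<gamma> j)
                   - 4 * real p / (real p - 2) * (dstar d \<gamma> (nu_idx p d a) / real (nu_idx p d a)))
            \<le> (\<Sum>j\<in>{1..p}. d j) - (\<Sum>j\<in>{3..p}. dstar d \<gamma> j) + (dstar d \<gamma> 3 + dstar d \<gamma> 4))"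
proof -
  interpret cstar_maximizer p d \<gamma> a
    by unfold_locales (use p3 dpos gnn sorted a_feas a_max in auto)
  show ?thesis
    unfolding nu_idx_eq
    using bayes_risk_le_if_\<nu>_eq_3 bound_le_if_\<nu>_eq_3 bayes_risk_le_if_\<nu>_ge_4 bound_le_if_\<nu>_ge_4
    by blast
qed

end
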